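(* Let $X,Y$ be complete metric spaces. The map $\Delta:P(X\otimes Y)\to PX\otimes PY$ is proper, i.e. preimages of compact sets are compact.
   Context: For metric spaces $X,Y$, $X\otimes Y$ is the cartesian product with the metric $d((x,y),(x',y'))=d(x,x')+d(y,y')$. $PX$ is the set of Radon probability measures $p$ on $X$ of finite first moment, i.e. such that $\int f\,dp$ exists and is finite for every 1-Lipschitz $f:X\to\mathbb{R}$, equipped with the Kantorovich–Wasserstein metric $d(p,q)=\inf_{r}\int d(x,y)\,dr(x,y)$, the infimum ranging over couplings $r$ of $p$ and $q$ (probability measures on $X\times X$ with marginals $p$ and $q$). $\Delta$ sends $r\in P(X\otimes Y)$ to the pair $(r_X,r_Y)$ of its marginals. *)

theory Defs
  imports "HOL-Probability.Probability"
begin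

text \<open>
  A metric space is a pair of a carrier set and a distance function, in the sense of the locale
  \<^locale>\<open>Metric_space\<close>.  Its topology is \<^const>\<open>Metric_space.mtopology\<close>.
\<close>

text \<open>The library's \<^const>\<open>prod_dist\<close> is the \<open>l\<^sup>2\<close>-distance; here the two distances are added.\<close>

definition sum_dist :: "('a \<Rightarrow> 'a \<Rightarrow> real) \<Rightarrow> ('b \<Rightarrow> 'b \<Rightarrow> real) \<Rightarrow> 'a \<times> 'b \<Rightarrow> 'a \<times> 'b \<Rightarrow> real"
  where "sum_dist d e = (\<lambda>(x, y) (x', y'). d x x' + e y y')"

definition borel_on :: "'a set \<Rightarrow> ('a \<Rightarrow> 'a \<Rightarrow> real) \<Rightarrow> 'a measure"
  where "borel_on X d = sigma X {U. openin (Metric_space.mtopology X d) U}"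

definition radon_prob :: "'a set \<Rightarrow> ('a \<Rightarrow> 'a \<Rightarrow> real) \<Rightarrow> 'a measure \<Rightarrow> bool"
  where "radon_prob X d p \<longleftrightarrow>
    prob_space p \<and> sets p = sets (borel_on X d) \<and>
    (\<forall>A\<in>sets p. emeasure p A =
      (SUP K\<in>{K. compactin (Metric_space.mtopology X d) K \<and> K \<subseteq> A}. emeasure p K))"

definition finite_first_moment :: "'a set \<Rightarrow> ('a \<Rightarrow> 'a \<Rightarrow> real) \<Rightarrow> 'a measure \<Rightarrow> bool"
  where "finite_first_moment X d p \<longleftrightarrow>
    (\<forall>f :: 'a \<Rightarrow> real. (\<forall>x\<in>X. \<forall>y\<in>X. \<bar>f x - f y\<bar> \<le> d x y) \<longrightarrow> integrable p f)"

definition kantorovich_space :: "'a set \<Rightarrow> ('a \<Rightarrow> 'a \<Rightarrow> real) \<Rightarrow> 'a measure set"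
  where "kantorovich_space X d = {p. radon_prob X d p \<and> finite_first_moment X d p}"

definition marginals ::
  "'a set \<Rightarrow> ('a \<Rightarrow> 'a \<Rightarrow> real) \<Rightarrow> 'b set \<Rightarrow> ('b \<Rightarrow> 'b \<Rightarrow> real) \<Rightarrow>
    ('a \<times> 'b) measure \<Rightarrow> 'a measure \<times> 'b measure"
  where "marginals X d Y e r =
    (distr r (borel_on X d) fst, distr r (borel_on Y e) snd)"

text \<open>
  Couplings are Borel measures for the product topology on \<open>X \<times> X\<close>.  If \<open>X\<close> is not separable,
  the product of the Borel \<open>\<sigma>\<close>-algebras may be smaller, and the distance function need
  not be measurable with respect to it.
\<close>

definition couplings ::
  "'a set \<Rightarrow> ('a \<Rightarrow> 'a \<Rightarrow> real) \<Rightarrow> 'a measure \<Rightarrow> 'a measure \<Rightarrow> ('a \<times> 'a) measure set"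
  where "couplings X d p q =
    {r. prob_space r \<and> sets r = sets (borel_on (X \<times> X) (sum_dist d d)) \<and>
        marginals X d X d r = (p, q)}"

text \<open>
  The value \<open>0\<close> outside of \<^const>\<open>kantorovich_space\<close> is a dummy: \<^locale>\<open>Metric_space\<close> requires
  non-negativity and symmetry on the whole type.
\<close>

definition kantorovich_dist ::
  "'a set \<Rightarrow> ('a \<Rightarrow> 'a \<Rightarrow> real) \<Rightarrow> 'a measure \<Rightarrow> 'a measure \<Rightarrow> real"
  where "kantorovich_dist X d p q =
    (if p \<in> kantorovich_space X d \<and> q \<in> kantorovich_space X d
     then INF r\<in>couplings X d p q. \<integral>(x, y). d x y \<partial>r else 0)"

lemma sum_dist_simp [simp]: "sum_dist d e (x, y) (x', y') = d x x' + e y y'"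
  by (simp add: sum_dist_def)

lemma Metric_space_sum_dist:
  assumes "Metric_space X d" "Metric_space Y e"
  shows "Metric_space (X \<times> Y) (sum_dist d e)"
proof -
  interpret X: Metric_space X d by fact
  interpret Y: Metric_space Y e by fact
  show ?thesis
  proof
    fix u v w
    show "0 \<le> sum_dist d e u v" by (cases u; cases v) simp
    show "sum_dist d e u v = sum_dist d e v u"
      by (cases u; cases v) (simp add: X.commute Y.commute)
    assume u: "u \<in> X \<times> Y" and v: "v \<in> X \<times> Y"
    then show "sum_dist d e u v = 0 \<longleftrightarrow> u = v"
      by (cases u; cases v) (simp add: add_nonneg_eq_0_iff)
    assume w: "w \<in> X \<times> Y"
    obtain a b where [simp]: "u = (a, b)" by (cases u)
    obtain a' b' where [simp]: "v = (a', b')" by (cases v)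
    obtain a'' b'' where [simp]: "w = (a'', b'')" by (cases w)
    show "sum_dist d e u w \<le> sum_dist d e u v + sum_dist d e v w"
      using X.triangle[of a a' a''] Y.triangle[of b b' b''] u v w by simp
  qed
qed

lemma space_borel_on [simp]: "space (borel_on X d) = X"
  by (simp add: borel_on_def space_measure_of_conv)

lemma sets_borel_on:
  assumes "Metric_space X d"
  shows "sets (borel_on X d) = sigma_sets X {U. openin (Metric_space.mtopology X d) U}"
proof -
  have "{U. openin (Metric_space.mtopology X d) U} \<subseteq> Pow X"
    using openin_subset[of "Metric_space.mtopology X d"] assms
    by (auto simp: Metric_space.topspace_mtopology)
  then show ?thesis by (simp add: borel_on_def)
qed

lemma continuous_map_measurable_borel_on:
  assumes "Metric_space X d" "Metric_space Y e"
    and f: "continuous_map (Metric_space.mtopology X d) (Metric_space.mtopology Y e) f"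
  shows "f \<in> measurable (borel_on X d) (borel_on Y e)"
proof -
  interpret X: Metric_space X d by fact
  interpret Y: Metric_space Y e by fact
  show ?thesis
    unfolding borel_on_def[of Y]
  proof (rule measurable_measure_of)
    show "{U. openin Y.mtopology U} \<subseteq> Pow Y"
      using openin_subset[of Y.mtopology] by auto
    show "f \<in> space (borel_on X d) \<rightarrow> Y"
      using f by (auto simp: continuous_map_def)
    fix U assume "U \<in> {U. openin Y.mtopology U}"
    then have "openin X.mtopology {x \<in> X. f x \<in> U}"
      using f by (auto simp: continuous_map_def)
    moreover have "f -` U \<inter> space (borel_on X d) = {x \<in> X. f x \<in> U}" by auto
    ultimately show "f -` U \<inter> space (borel_on X d) \<in> sets (borel_on X d)"
      by (simp add: sets_borel_on[OF assms(1)] sigma_sets.Basic)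
  qed
qed

lemma nonexpansive_continuous_map:
  assumes "Metric_space X d" "Metric_space Y e"
    and f: "\<And>x. x \<in> X \<Longrightarrow> f x \<in> Y" "\<And>x y. x \<in> X \<Longrightarrow> y \<in> X \<Longrightarrow> e (f x) (f y) \<le> d x y"
  shows "continuous_map (Metric_space.mtopology X d) (Metric_space.mtopology Y e) f"
proof -
  interpret X: Metric_space X d by fact
  interpret Y: Metric_space Y e by fact
  show ?thesis
    unfolding Metric_space.metric_continuous_map[OF assms(1,2)]
    using f by (meson image_subsetI order_le_less_trans)
qed

lemma continuous_map_fst_snd_sum_dist:
  assumes "Metric_space X d" "Metric_space Y e"
  shows "continuous_map (Metric_space.mtopology (X \<times> Y) (sum_dist d e))
           (Metric_space.mtopology X d) fst"
    and "continuous_map (Metric_space.mtopology (X \<times> Y) (sum_dist d e))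
           (Metric_space.mtopology Y e) snd"
proof -
  interpret X: Metric_space X d by fact
  interpret Y: Metric_space Y e by fact
  show "continuous_map (Metric_space.mtopology (X \<times> Y) (sum_dist d e)) X.mtopology fst"
    by (rule nonexpansive_continuous_map[OF Metric_space_sum_dist[OF assms] assms(1)]) auto
  show "continuous_map (Metric_space.mtopology (X \<times> Y) (sum_dist d e)) Y.mtopology snd"
    by (rule nonexpansive_continuous_map[OF Metric_space_sum_dist[OF assms] assms(2)]) auto
qed

lemma distr_in_kantorovich_space:
  assumes X: "Metric_space X d" and Y: "Metric_space Y e"
    and f: "\<And>x. x \<in> X \<Longrightarrow> f x \<in> Y" "\<And>x y. x \<in> X \<Longrightarrow> y \<in> X \<Longrightarrow> e (f x) (f y) \<le> d x y"
    and r: "r \<in> kantorovich_space X d"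
  shows "distr r (borel_on Y e) f \<in> kantorovich_space Y e"
proof -
  interpret X: Metric_space X d by fact
  interpret Y: Metric_space Y e by fact
  let ?p = "distr r (borel_on Y e) f"
  have rad: "prob_space r" "sets r = sets (borel_on X d)"
    and inner: "\<And>A. A \<in> sets r \<Longrightarrow>
      emeasure r A = (SUP K\<in>{K. compactin X.mtopology K \<and> K \<subseteq> A}. emeasure r K)"
    and mom: "finite_first_moment X d r"
    using r by (auto simp: kantorovich_space_def radon_prob_def)
  have space_r: "space r = X"
    using sets_eq_imp_space_eq[OF rad(2)] by simp
  have cont: "continuous_map X.mtopology Y.mtopology f"
    by (rule nonexpansive_continuous_map[OF X Y f])
  have meas: "f \<in> measurable r (borel_on Y e)"
    using continuous_map_measurable_borel_on[OF X Y cont] rad(2)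
    by (simp cong: measurable_cong_sets)
  have compact_sets: "K \<in> sets (borel_on Y e)" if "compactin Y.mtopology K" for K
  proof -
    have "closedin Y.mtopology K"
      using that compactin_imp_closedin Y.Hausdorff_space_mtopology by blast
    then have "openin Y.mtopology (Y - K)" "K \<subseteq> Y"
      by (auto simp: closedin_def)
    then have "Y - (Y - K) \<in> sets (borel_on Y e)"
      by (simp add: sets_borel_on[OF Y] sigma_sets.Basic sigma_sets.Compl)
    then show ?thesis using \<open>K \<subseteq> Y\<close> by (simp add: double_diff)
  qed
  have "radon_prob Y e ?p"
    unfolding radon_prob_def
  proof (intro conjI ballI)
    show "prob_space ?p" by (rule prob_space.prob_space_distr[OF rad(1) meas])
    show "sets ?p = sets (borel_on Y e)" by simp
    fix A assume A: "A \<in> sets ?p"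
    let ?B = "f -` A \<inter> space r"
    have B: "?B \<in> sets r" using meas A by (auto intro: measurable_sets)
    show "emeasure ?p A = (SUP K\<in>{K. compactin Y.mtopology K \<and> K \<subseteq> A}. emeasure ?p K)"
    proof (rule antisym)
      have "emeasure ?p A = emeasure r ?B" using A meas by (simp add: emeasure_distr)
      also have "\<dots> = (SUP K\<in>{K. compactin X.mtopology K \<and> K \<subseteq> ?B}. emeasure r K)"
        by (rule inner[OF B])
      also have "\<dots> \<le> (SUP K\<in>{K. compactin Y.mtopology K \<and> K \<subseteq> A}. emeasure ?p K)"
      proof (rule SUP_mono)
        fix K assume "K \<in> {K. compactin X.mtopology K \<and> K \<subseteq> ?B}"
        then have K: "compactin X.mtopology K" "K \<subseteq> ?B" by auto
        have fK: "compactin Y.mtopology (f ` K)" by (rule image_compactin[OF K(1) cont])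
        have "emeasure r K \<le> emeasure r (f -` (f ` K) \<inter> space r)"
          using K(2) measurable_sets[OF meas compact_sets[OF fK]]
          by (intro emeasure_mono) auto
        also have "\<dots> = emeasure ?p (f ` K)"
          using meas compact_sets[OF fK] by (simp add: emeasure_distr)
        finally show "\<exists>K'\<in>{K. compactin Y.mtopology K \<and> K \<subseteq> A}. emeasure r K \<le> emeasure ?p K'"
          using fK K(2) by (intro bexI[of _ "f ` K"]) auto
      qed
      finally show "emeasure ?p A \<le> (SUP K\<in>{K. compactin Y.mtopology K \<and> K \<subseteq> A}. emeasure ?p K)" .
      show "(SUP K\<in>{K. compactin Y.mtopology K \<and> K \<subseteq> A}. emeasure ?p K) \<le> emeasure ?p A"
        using A by (intro SUP_least emeasure_mono) auto
    qed
  qed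
  moreover have "finite_first_moment Y e ?p"
    unfolding finite_first_moment_def
  proof (intro allI impI)
    fix g :: "_ \<Rightarrow> real" assume g: "\<forall>x\<in>Y. \<forall>y\<in>Y. \<bar>g x - g y\<bar> \<le> e x y"
    have "continuous_map Y.mtopology Met_TC.mtopology g"
      using g by (intro nonexpansive_continuous_map[OF Y Met_TC.Metric_space_axioms])
        (auto simp: dist_real_def)
    then have contg: "continuous_map Y.mtopology euclidean g"
      by (simp add: Met_TC.mtopology_def Met_TC.mopen_def mtopology_is_euclidean)
    have "g \<in> borel_measurable (borel_on Y e)"
    proof (rule borel_measurableI)
      fix S :: "real set" assume "open S"
      then have "openin Y.mtopology {x \<in> Y. g x \<in> S}"
        using contg by (auto simp: continuous_map_def)
      moreover have "g -` S \<inter> space (borel_on Y e) = {x \<in> Y. g x \<in> S}" by auto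
      ultimately show "g -` S \<inter> space (borel_on Y e) \<in> sets (borel_on Y e)"
        by (simp add: sets_borel_on[OF Y] sigma_sets.Basic)
    qed
    moreover have "integrable r (\<lambda>x. g (f x))"
    proof -
      have "\<bar>g (f x) - g (f y)\<bar> \<le> d x y" if "x \<in> X" "y \<in> X" for x y
        using g f(1)[OF that(1)] f(1)[OF that(2)] f(2)[OF that] by force
      then show ?thesis using mom by (simp add: finite_first_moment_def)
    qed
    ultimately show "integrable ?p g"
      using meas by (simp add: integrable_distr_eq)
  qed
  ultimately show ?thesis by (simp add: kantorovich_space_def)
qed

lemma marginals_in_kantorovich_space:
  assumes X: "Metric_space X d" and Y: "Metric_space Y e"
  shows "marginals X d Y e \<in>
    kantorovich_space (X \<times> Y) (sum_dist d e) \<rightarrow> kantorovich_space X d \<times> kantorovich_space Y e"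
proof
  interpret X: Metric_space X d by fact
  interpret Y: Metric_space Y e by fact
  note XY = Metric_space_sum_dist[OF X Y]
  fix r assume r: "r \<in> kantorovich_space (X \<times> Y) (sum_dist d e)"
  have "distr r (borel_on X d) fst \<in> kantorovich_space X d"
    by (rule distr_in_kantorovich_space[OF XY X _ _ r]) auto
  moreover have "distr r (borel_on Y e) snd \<in> kantorovich_space Y e"
    by (rule distr_in_kantorovich_space[OF XY Y _ _ r]) auto
  ultimately show "marginals X d Y e r \<in> kantorovich_space X d \<times> kantorovich_space Y e"
    by (simp add: marginals_def)
qed

end

theory Submission
  imports Defs
begin

text \<open>
  Write \<open>W\<close> for the Kantorovich distance.  Since \<open>\<integral> d(S, y) dp(y)\<close> is \<open>W\<close>-Lipschitz in \<open>p\<close> and can be made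
  small by the choice of a finite set \<open>S\<close>, a compact set of measures admits a single finite set \<open>S\<close> for
  which these integrals are uniformly small.  Finite sets for the two compact sets of marginals
  combine to their product, which serves all measures with these marginals.  It remains to see that
  this property gives every sequence of measures a \<open>W\<close>-convergent subsequence: replace a point by the
  sequence of its nearest points in finite sets \<open>S\<^sub>0, S\<^sub>1, \<dots>\<close> of increasing accuracy.  By Helly and Skorohod,
  the laws of these sequences have a subsequence that is realised by almost surely convergent random
  variables; their limit is almost surely a Cauchy sequence in the space, and the law of its limit is
  the limit measure.  The fibre over a compact set is closed because the marginal map is nonexpansive.
\<close>

section \<open>Couplings and the product Borel structure\<close>

text \<open>The spaces are not assumed separable, so a pair of Borel maps may fail to be Borel for
  the product topology, and the distance of two random variables may fail to be measurable. Inner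
  regularity is the remedy: a Radon measure is concentrated on the closure of a sequence. Random
  variables are therefore altered on a null set before they are paired, and costs are bounded
  through an integrable majorant. The mean distance to a finite set controls tightness and the tails
  of the first moment at once, and it is the integral of a 1-Lipschitz function. In the sum metric
  the distance to A x B is the distance to A plus the distance to B, so the estimates for the two
  marginals simply add up. The accuracies are powers of 1/2 because their summability is what makes
  the limiting approximations almost surely Cauchy. Completeness supplies their limit, and it enters
  again when the limit law is shown to be Radon.\<close>

context Metric_space
begin

lemma openin_in_borel_on: "openin mtopology U \<Longrightarrow> U \<in> sets (borel_on M d)"
  by (simp add: sets_borel_on[OF Metric_space_axioms] sigma_sets.Basic)

lemma closedin_in_borel_on: "closedin mtopology C \<Longrightarrow> C \<in> sets (borel_on M d)"
  using sets.compl_sets[OF openin_in_borel_on, of "M - C"]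
  by (auto simp: closedin_def double_diff)

lemma Lipschitz_borel_measurable:
  fixes f :: "'a \<Rightarrow> real"
  assumes f: "\<And>x y. x \<in> M \<Longrightarrow> y \<in> M \<Longrightarrow> \<bar>f x - f y\<bar> \<le> d x y"
  shows "f \<in> borel_measurable (borel_on M d)"
proof (rule borel_measurableI)
  fix S :: "real set" assume "open S"
  have "continuous_map mtopology Met_TC.mtopology f"
    using f by (intro nonexpansive_continuous_map Metric_space_axioms Met_TC.Metric_space_axioms)
      (auto simp: dist_real_def)
  then have "openin mtopology {x \<in> M. f x \<in> S}"
    using \<open>open S\<close> by (auto simp: continuous_map_def)
  moreover have "f -` S \<inter> space (borel_on M d) = {x \<in> M. f x \<in> S}" by auto
  ultimately show "f -` S \<inter> space (borel_on M d) \<in> sets (borel_on M d)"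
    by (simp add: openin_in_borel_on)
qed

lemma dist_measurable: "(\<lambda>y. d x y) \<in> borel_measurable (borel_on M d)" if "x \<in> M"
  using that by (intro Lipschitz_borel_measurable) (smt (verit) commute triangle)

lemma Metric_space_sum_self: "Metric_space (M \<times> M) (sum_dist d d)"
  by (intro Metric_space_sum_dist Metric_space_axioms)

lemma dist_pair_measurable:
  "(\<lambda>u. d (fst u) (snd u)) \<in> borel_measurable (borel_on (M \<times> M) (sum_dist d d))"
proof -
  interpret S: Metric_space "M \<times> M" "sum_dist d d" by (rule Metric_space_sum_self)
  show ?thesis
  proof (rule S.Lipschitz_borel_measurable)
    fix u v assume "u \<in> M \<times> M" "v \<in> M \<times> M"
    moreover obtain a b a' b' where "u = (a, b)" "v = (a', b')" by (cases u; cases v)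
    ultimately show "\<bar>d (fst u) (snd u) - d (fst v) (snd v)\<bar> \<le> sum_dist d d u v"
      using triangle[of a a' b] triangle[of a' b' b] triangle[of a' a b'] triangle[of a b b']
      by (auto simp: commute)
  qed
qed

text \<open>
  On a non-separable space the Borel sets of the product may be more than the product of the Borel
  sets, hence the condition that one component ranges in the closure of a sequence.
\<close>

lemma pair_measurable:
  assumes Y: "Metric_space Y e"
    and f: "f \<in> measurable N (borel_on M d)" and g: "g \<in> measurable N (borel_on Y e)"
    and dense: "\<And>w \<delta>. w \<in> space N \<Longrightarrow> 0 < \<delta> \<Longrightarrow> \<exists>i::nat. e (g w) (y i) < \<delta>"
    and y: "range y \<subseteq> Y"
  shows "(\<lambda>w. (f w, g w)) \<in> measurable N (borel_on (M \<times> Y) (sum_dist d e))"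
proof -
  interpret Y: Metric_space Y e by fact
  interpret S: Metric_space "M \<times> Y" "sum_dist d e"
    by (intro Metric_space_sum_dist Metric_space_axioms Y)
  have fM: "f w \<in> M" and gY: "g w \<in> Y" if "w \<in> space N" for w
    using measurable_space[OF f that] measurable_space[OF g that] by auto
  show ?thesis
    unfolding borel_on_def[of "M \<times> Y"]
  proof (rule measurable_measure_of)
    show "{U. openin S.mtopology U} \<subseteq> Pow (M \<times> Y)"
      using openin_subset[of S.mtopology] by auto
    show "(\<lambda>w. (f w, g w)) \<in> space N \<rightarrow> M \<times> Y" using fM gY by auto
    fix U assume "U \<in> {U. openin S.mtopology U}"
    then have U: "openin S.mtopology U" by simp
    \<comment> \<open>\<open>U\<close> becomes a countable union of rectangles. Only the second
      sides need a countable supply of balls; \<open>V i n\<close> is the largest open set that fits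
      beside \<open>B i n\<close>, so no countable base of the first factor is involved.\<close>
    define B where "B i n = Y.mball (y i) (inverse (real (Suc n)))" for i n
    define V where "V i n = \<Union>{V. openin mtopology V \<and> V \<times> B i n \<subseteq> U}" for i n
    have V: "V i n \<in> sets (borel_on M d)" for i n
      unfolding V_def by (intro openin_in_borel_on openin_Union) auto
    have B: "B i n \<in> sets (borel_on Y e)" for i n
      unfolding B_def by (intro Y.openin_in_borel_on) auto
    have "(\<lambda>w. (f w, g w)) -` U \<inter> space N =
      (\<Union>i. \<Union>n. (f -` V i n \<inter> space N) \<inter> (g -` B i n \<inter> space N))" (is "?L = ?R")
    proof (intro equalityI subsetI)
      fix w assume w: "w \<in> ?L"
      then obtain r where r: "r > 0" "S.mball (f w, g w) r \<subseteq> U"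
        using U unfolding S.openin_mtopology by blast
      \<comment> \<open>The centre of \<open>B i n\<close> may be r / 4 away from
        \<open>g w\<close>, so the ball reaches at most r / 2 from it; the other half of r is left
        for the first coordinate.\<close>
      obtain n where n: "inverse (real (Suc n)) < r / 4"
        using r(1) reals_Archimedean[of "r / 4"] by auto
      obtain i where i: "e (g w) (y i) < inverse (real (Suc n))"
        using dense[of w "inverse (real (Suc n))"] w by auto
      have "mball (f w) (r / 2) \<times> B i n \<subseteq> S.mball (f w, g w) r"
      proof
        fix u assume "u \<in> mball (f w) (r / 2) \<times> B i n"
        then obtain a b where u: "u = (a, b)" "a \<in> M" "b \<in> Y" "d (f w) a < r / 2"
          "e (y i) b < inverse (real (Suc n))" by (auto simp: B_def)
        moreover have "e (g w) b \<le> e (g w) (y i) + e (y i) b"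
          using u y gY w by (intro Y.triangle) auto
        ultimately show "u \<in> S.mball (f w, g w) r"
          using fM gY w i n by auto
      qed
      then have "mball (f w) (r / 2) \<subseteq> V i n"
        using r(2) unfolding V_def by (intro Union_upper) auto
      moreover have "f w \<in> mball (f w) (r / 2)" using fM w r by auto
      moreover have "g w \<in> B i n"
        using w i gY y by (auto simp: B_def Y.commute)
      ultimately show "w \<in> ?R" using w by blast
    next
      fix w assume "w \<in> ?R"
      then show "w \<in> ?L" by (auto simp: V_def)
    qed
    also have "\<dots> \<in> sets N"
      by (intro sets.countable_nat_UN sets.Int measurable_sets[OF f V] measurable_sets[OF g B] image_subsetI)
    finally show "(\<lambda>w. (f w, g w)) -` U \<inter> space N \<in> sets N" .
  qed
qed

section \<open>Couplings, their marginals and their cost\<close>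

lemma prob_space_coupling: "r \<in> couplings M d p q \<Longrightarrow> prob_space r"
  by (simp add: couplings_def)

lemma sets_coupling: "r \<in> couplings M d p q \<Longrightarrow> sets r = sets (borel_on (M \<times> M) (sum_dist d d))"
  by (simp add: couplings_def)

lemma space_coupling: "r \<in> couplings M d p q \<Longrightarrow> space r = M \<times> M"
  using sets_eq_imp_space_eq[OF sets_coupling] by simp

lemma coupling_marginals:
  assumes r: "r \<in> couplings M d p q"
  shows "fst \<in> measurable r (borel_on M d)" "snd \<in> measurable r (borel_on M d)"
    "distr r (borel_on M d) fst = p" "distr r (borel_on M d) snd = q"
  using r
    continuous_map_measurable_borel_on[OF Metric_space_sum_self Metric_space_axioms
      continuous_map_fst_snd_sum_dist(1)[OF Metric_space_axioms Metric_space_axioms]]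
    continuous_map_measurable_borel_on[OF Metric_space_sum_self Metric_space_axioms
      continuous_map_fst_snd_sum_dist(2)[OF Metric_space_axioms Metric_space_axioms]]
  by (auto simp: couplings_def marginals_def cong: measurable_cong_sets)

lemma kantorovich_spaceD:
  assumes "p \<in> kantorovich_space M d"
  shows "prob_space p" "sets p = sets (borel_on M d)" "space p = M"
    "(\<And>x y. x \<in> M \<Longrightarrow> y \<in> M \<Longrightarrow> \<bar>f x - f y\<bar> \<le> d x y) \<Longrightarrow> integrable p (f :: 'a \<Rightarrow> real)"
  using assms sets_eq_imp_space_eq[of p "borel_on M d"]
  by (auto simp: kantorovich_space_def radon_prob_def finite_first_moment_def)

lemma integrable_dist:
  assumes "p \<in> kantorovich_space M d" "x \<in> M"
  shows "integrable p (\<lambda>y. d x y)"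
  using assms by (intro kantorovich_spaceD(4)) (auto, smt (verit) commute triangle)

lemma integral_marginal:
  fixes f :: "'a \<Rightarrow> real"
  assumes r: "r \<in> couplings M d p q" and f: "f \<in> borel_measurable (borel_on M d)"
  shows "integrable p f \<longleftrightarrow> integrable r (\<lambda>u. f (fst u))" "integrable q f \<longleftrightarrow> integrable r (\<lambda>u. f (snd u))"
    "(\<integral>x. f x \<partial>p) = (\<integral>u. f (fst u) \<partial>r)" "(\<integral>x. f x \<partial>q) = (\<integral>u. f (snd u) \<partial>r)"
  using integrable_distr_eq[OF coupling_marginals(1)[OF r] f] integrable_distr_eq[OF coupling_marginals(2)[OF r] f]
    integral_distr[OF coupling_marginals(1)[OF r] f] integral_distr[OF coupling_marginals(2)[OF r] f]
  by (simp_all add: coupling_marginals[OF r])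

lemma kantorovich_space_nonempty: "p \<in> kantorovich_space M d \<Longrightarrow> M \<noteq> {}"
  using prob_space.not_empty kantorovich_spaceD(1,3) by metis

text \<open>Through a base point the cost is dominated by a sum of two functions of one coordinate
  each, which are integrable by the finite first moments of the marginals.\<close>

lemma integrable_dist_coupling:
  assumes p: "p \<in> kantorovich_space M d" and q: "q \<in> kantorovich_space M d"
    and r: "r \<in> couplings M d p q"
  shows "integrable r (\<lambda>u. d (fst u) (snd u))"
proof -
  obtain x where x: "x \<in> M" using kantorovich_space_nonempty[OF p] by auto
  have "integrable r (\<lambda>u. d x (fst u))" "integrable r (\<lambda>u. d x (snd u))"
    using integral_marginal(1,2)[OF r dist_measurable[OF x]] integrable_dist[OF p x] integrable_dist[OF q x]
    by auto
  then have "integrable r (\<lambda>u. d x (fst u) + d x (snd u))" by (rule Bochner_Integration.integrable_add)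
  then show ?thesis
  proof (rule Bochner_Integration.integrable_bound)
    show "(\<lambda>u. d (fst u) (snd u)) \<in> borel_measurable r"
      using dist_pair_measurable sets_coupling[OF r] by (simp cong: measurable_cong_sets)
    show "AE u in r. norm (d (fst u) (snd u)) \<le> norm (d x (fst u) + d x (snd u))"
    proof (rule AE_I2)
      fix u assume "u \<in> space r"
      then have "fst u \<in> M" "snd u \<in> M" by (auto simp: space_coupling[OF r])
      then show "norm (d (fst u) (snd u)) \<le> norm (d x (fst u) + d x (snd u))"
        using triangle''[of "fst u" x "snd u"] x by simp
    qed
  qed
qed

lemma kantorovich_dist_le:
  assumes "r \<in> couplings M d p q" "p \<in> kantorovich_space M d" "q \<in> kantorovich_space M d"
  shows "kantorovich_dist M d p q \<le> (\<integral>u. d (fst u) (snd u) \<partial>r)"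
proof -
  have "(INF r\<in>couplings M d p q. \<integral>u. d (fst u) (snd u) \<partial>r) \<le> (\<integral>u. d (fst u) (snd u) \<partial>r)"
    by (rule cINF_lower[OF bdd_belowI2[of _ 0] assms(1)]) simp
  then show ?thesis using assms by (simp add: kantorovich_dist_def case_prod_beta')
qed

text \<open>A real infimum over the empty set has no useful value, so the existence of a coupling
  has to be assumed; \<open>couplings_nonempty\<close> provides it later.\<close>

lemma le_kantorovich_dist:
  assumes "p \<in> kantorovich_space M d" "q \<in> kantorovich_space M d" "couplings M d p q \<noteq> {}"
    and "\<And>r. r \<in> couplings M d p q \<Longrightarrow> c \<le> (\<integral>u. d (fst u) (snd u) \<partial>r)"
  shows "c \<le> kantorovich_dist M d p q"
  using assms by (auto simp: kantorovich_dist_def case_prod_beta' intro!: cINF_greatest)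

lemma kantorovich_dist_less_coupling:
  assumes "p \<in> kantorovich_space M d" "q \<in> kantorovich_space M d" "couplings M d p q \<noteq> {}"
    and "kantorovich_dist M d p q < c"
  obtains r where "r \<in> couplings M d p q" "(\<integral>u. d (fst u) (snd u) \<partial>r) < c"
  using le_kantorovich_dist[OF assms(1-3), of c] assms(4) by force

text \<open>The easy half of Kantorovich-Rubinstein duality, for a single coupling.\<close>

lemma abs_integral_diff_le_coupling:
  fixes f :: "'a \<Rightarrow> real"
  assumes p: "p \<in> kantorovich_space M d" and q: "q \<in> kantorovich_space M d"
    and r: "r \<in> couplings M d p q" and f: "\<And>x y. x \<in> M \<Longrightarrow> y \<in> M \<Longrightarrow> \<bar>f x - f y\<bar> \<le> d x y"
  shows "\<bar>(\<integral>x. f x \<partial>p) - (\<integral>x. f x \<partial>q)\<bar> \<le> (\<integral>u. d (fst u) (snd u) \<partial>r)"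
proof -
  note m = integral_marginal[OF r Lipschitz_borel_measurable[OF f], simplified]
  have i: "integrable r (\<lambda>u. f (fst u))" "integrable r (\<lambda>u. f (snd u))"
    using m(1,2) kantorovich_spaceD(4)[OF p f] kantorovich_spaceD(4)[OF q f] by auto
  have "\<bar>(\<integral>x. f x \<partial>p) - (\<integral>x. f x \<partial>q)\<bar> = \<bar>\<integral>u. f (fst u) - f (snd u) \<partial>r\<bar>"
    using m(3,4) i by simp
  also have "\<dots> \<le> (\<integral>u. \<bar>f (fst u) - f (snd u)\<bar> \<partial>r)"
    by (rule integral_abs_bound)
  also have "\<dots> \<le> (\<integral>u. d (fst u) (snd u) \<partial>r)"
    using f by (intro integral_mono integrable_dist_coupling[OF p q r] integrable_abs Bochner_Integration.integrable_diff i)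
      (auto simp: space_coupling[OF r])
  finally show ?thesis .
qed

end

section \<open>The Kantorovich metric\<close>

text \<open>
  The gluing of couplings along a common marginal would need disintegration; for the triangle
  inequality it is enough to match the common points up to a countable partition into small pieces.
\<close>

lemma discrete_gluing:
  fixes a :: "'b measure" and b :: "'c measure" and i :: "'b \<Rightarrow> nat" and j :: "'c \<Rightarrow> nat"
  assumes a: "prob_space a" and b: "prob_space b"
    and i[measurable]: "i \<in> measurable a (count_space UNIV)"
    and j[measurable]: "j \<in> measurable b (count_space UNIV)"
    and same: "distr a (count_space UNIV) i = distr b (count_space UNIV) j"
  obtains N where "prob_space N" "sets N = sets (a \<Otimes>\<^sub>M b)" "distr N a fst = a" "distr N b snd = b"
    "AE u in N. i (fst u) = j (snd u)"
proof -
  interpret a: prob_space a by fact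
  interpret b: prob_space b by fact
  interpret ab: pair_prob_space a b ..
  define k where "k n = emeasure a (i -` {n} \<inter> space a)" for n
  have k': "k n = emeasure b (j -` {n} \<inter> space b)" for n
    using arg_cong[OF same, of "\<lambda>m. emeasure m {n}"] by (simp add: k_def emeasure_distr)
  have inv_k: "inverse (k n) * k n = 1" if "k n \<noteq> 0" for n
    using that ennreal_divide_self[of "k n"] a.emeasure_finite[of "i -` {n} \<inter> space a"]
    by (simp add: k_def less_top[symmetric] divide_ennreal_def mult.commute)
  \<comment> \<open>There are only countably many labels, so those of mass zero together form a null
    set; at all others \<open>inverse (k n)\<close> is finite and cancels
    \<open>k n\<close>.\<close>
  have pos_a: "AE x in a. k (i x) \<noteq> 0"
  proof -
    have "AE x in a. \<forall>n. \<not> (i x = n \<and> k n = 0)"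
      unfolding AE_all_countable
    proof
      fix n
      show "AE x in a. \<not> (i x = n \<and> k n = 0)"
      proof (cases "k n = 0")
        case True
        then have "i -` {n} \<inter> space a \<in> null_sets a"
          by (intro null_setsI) (auto simp: k_def)
        then show ?thesis by (rule AE_I') auto
      qed auto
    qed
    then show ?thesis by auto
  qed
  have pos_b: "AE y in b. k (j y) \<noteq> 0"
  proof -
    have "AE y in b. \<forall>n. \<not> (j y = n \<and> k n = 0)"
      unfolding AE_all_countable
    proof
      fix n
      show "AE y in b. \<not> (j y = n \<and> k n = 0)"
      proof (cases "k n = 0")
        case True
        then have "j -` {n} \<inter> space b \<in> null_sets b"
          by (intro null_setsI) (auto simp: k')
        then show ?thesis by (rule AE_I') auto
      qed auto
    qed
    then show ?thesis by auto
  qed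
  \<comment> \<open>The density makes the two components conditionally independent given their
    common label: on the rectangle of label n the product measure is divided by the mass
    \<open>k n\<close> that both sides give to n. Integrating out one component leaves the factor
    \<open>inverse (k n) * k n = 1\<close>.\<close>
  define w where "w u = (if i (fst u) = j (snd u) then inverse (k (i (fst u))) else 0)" for u
  have [measurable]: "(\<lambda>u. inverse (k (i (fst u)))) \<in> borel_measurable (a \<Otimes>\<^sub>M b)"
    by (rule measurable_compose[where f="\<lambda>u. i (fst u)" and g="\<lambda>n. inverse (k n)" and N="count_space UNIV"])
      simp_all
  \<comment> \<open>Equality of the labels is a countable union of measurable rectangles.\<close>
  have "Measurable.pred (a \<Otimes>\<^sub>M b) (\<lambda>u. \<exists>n. i (fst u) = n \<and> j (snd u) = n)" by measurable
  then have [measurable]: "Measurable.pred (a \<Otimes>\<^sub>M b) (\<lambda>u. i (fst u) = j (snd u))"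
    by (simp add: eq_commute)
  have w[measurable]: "w \<in> borel_measurable (a \<Otimes>\<^sub>M b)"
    unfolding w_def by measurable
  define N where "N = density (a \<Otimes>\<^sub>M b) w"
  have setsN: "sets N = sets (a \<Otimes>\<^sub>M b)" by (simp add: N_def)
  have fstN: "emeasure N (fst -` A \<inter> space N) = emeasure a A" if [measurable]: "A \<in> sets a" for A
  proof -
    have "emeasure N (fst -` A \<inter> space N) =
        (\<integral>\<^sup>+u. w u * indicator (fst -` A \<inter> space (a \<Otimes>\<^sub>M b)) u \<partial>(a \<Otimes>\<^sub>M b))"
      unfolding N_def by (subst emeasure_density) auto
    also have "\<dots> = (\<integral>\<^sup>+u. w u * indicator A (fst u) \<partial>(a \<Otimes>\<^sub>M b))"
      by (intro nn_integral_cong) (auto simp: indicator_def)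
    also have "\<dots> = (\<integral>\<^sup>+x. \<integral>\<^sup>+y. w (x, y) * indicator A x \<partial>b \<partial>a)"
      by (subst b.nn_integral_fst[symmetric]) auto
    also have "\<dots> = (\<integral>\<^sup>+x. indicator A x \<partial>a)"
    proof (rule nn_integral_cong_AE, use pos_a in eventually_elim)
      fix x assume x: "k (i x) \<noteq> 0"
      have "(\<integral>\<^sup>+y. w (x, y) * indicator A x \<partial>b) =
          (\<integral>\<^sup>+y. (indicator A x * inverse (k (i x))) * indicator (j -` {i x} \<inter> space b) y \<partial>b)"
        by (intro nn_integral_cong) (auto simp: w_def indicator_def)
      also have "\<dots> = indicator A x * (inverse (k (i x)) * k (i x))"
        by (subst nn_integral_cmult_indicator) (auto simp: k' mult.assoc)
      finally show "(\<integral>\<^sup>+y. w (x, y) * indicator A x \<partial>b) = indicator A x"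
        by (simp add: inv_k[OF x])
    qed
    finally show ?thesis by simp
  qed
  have sndN: "emeasure N (snd -` A \<inter> space N) = emeasure b A" if [measurable]: "A \<in> sets b" for A
  proof -
    have "emeasure N (snd -` A \<inter> space N) =
        (\<integral>\<^sup>+u. w u * indicator (snd -` A \<inter> space (a \<Otimes>\<^sub>M b)) u \<partial>(a \<Otimes>\<^sub>M b))"
      unfolding N_def by (subst emeasure_density) auto
    also have "\<dots> = (\<integral>\<^sup>+u. w u * indicator A (snd u) \<partial>(a \<Otimes>\<^sub>M b))"
      by (intro nn_integral_cong) (auto simp: indicator_def)
    also have "\<dots> = (\<integral>\<^sup>+y. \<integral>\<^sup>+x. w (x, y) * indicator A y \<partial>a \<partial>b)"
      by (subst ab.nn_integral_snd[symmetric]) (auto simp: case_prod_beta')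
    also have "\<dots> = (\<integral>\<^sup>+y. indicator A y \<partial>b)"
    proof (rule nn_integral_cong_AE, use pos_b in eventually_elim)
      fix y assume y: "k (j y) \<noteq> 0"
      have "(\<integral>\<^sup>+x. w (x, y) * indicator A y \<partial>a) =
          (\<integral>\<^sup>+x. (indicator A y * inverse (k (j y))) * indicator (i -` {j y} \<inter> space a) x \<partial>a)"
        by (intro nn_integral_cong) (auto simp: w_def indicator_def)
      also have "\<dots> = indicator A y * (inverse (k (j y)) * k (j y))"
        by (subst nn_integral_cmult_indicator) (auto simp: k_def mult.assoc)
      finally show "(\<integral>\<^sup>+x. w (x, y) * indicator A y \<partial>a) = indicator A y"
        by (simp add: inv_k[OF y])
    qed
    finally show ?thesis by simp
  qed
  have meas: "fst \<in> measurable N a" "snd \<in> measurable N b"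
    by (simp_all add: N_def)
  show ?thesis
  proof
    show "prob_space N"
    proof
      have "fst -` space a \<inter> space N = space N" by (auto simp: N_def space_pair_measure)
      then show "emeasure N (space N) = 1"
        using fstN[of "space a"] a.emeasure_space_1 by simp
    qed
    show "sets N = sets (a \<Otimes>\<^sub>M b)" by fact
    show "distr N a fst = a"
      by (rule measure_eqI) (auto simp: emeasure_distr[OF meas(1)] fstN)
    show "distr N b snd = b"
      by (rule measure_eqI) (auto simp: emeasure_distr[OF meas(2)] sndN)
    show "AE u in N. i (fst u) = j (snd u)"
      unfolding N_def by (subst AE_density) (auto simp: w_def)
  qed
qed

section \<open>Couplings obtained from random variables\<close>

context Metric_space
begin

text \<open>Inner regularity of the whole space gives compact sets of mass tending to 1. Each is
  totally bounded, and the union of their finite nets is a countable set whose closure contains all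
  of them. This stands in for separability of the space.\<close>

lemma radon_prob_separable:
  assumes "radon_prob M d p"
  obtains x :: "nat \<Rightarrow> 'a" where "range x \<subseteq> M" "AE y in p. y \<in> mtopology closure_of range x"
proof -
  have p: "prob_space p" "sets p = sets (borel_on M d)"
    and inner: "\<And>A. A \<in> sets p \<Longrightarrow>
      emeasure p A = (SUP K\<in>{K. compactin mtopology K \<and> K \<subseteq> A}. emeasure p K)"
    using assms by (auto simp: radon_prob_def)
  interpret p: prob_space p by fact
  have space_p: "space p = M" using sets_eq_imp_space_eq[OF p(2)] by simp
  obtain x0 where x0: "x0 \<in> M" using p.not_empty space_p by auto
  have "\<exists>K. compactin mtopology K \<and> 1 - 1 / real (Suc n) < measure p K" for n
  proof -
    have "ennreal (1 - 1 / real (Suc n)) < 1" by (simp flip: ennreal_1 add: ennreal_less_iff)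
    also have "1 = (SUP K\<in>{K. compactin mtopology K \<and> K \<subseteq> space p}. emeasure p K)"
      using inner[of "space p"] p.emeasure_space_1 by simp
    finally obtain K where K: "compactin mtopology K" "ennreal (1 - 1 / real (Suc n)) < emeasure p K"
      by (auto simp: less_SUP_iff)
    then show ?thesis
      by (intro exI[of _ K]) (simp add: p.emeasure_eq_measure ennreal_less_iff)
  qed
  then obtain K where K: "\<And>n. compactin mtopology (K n)" "\<And>n. 1 - 1 / real (Suc n) < measure p (K n)"
    by metis
  have "\<exists>S. finite S \<and> S \<subseteq> K n \<and> K n \<subseteq> (\<Union>x\<in>S. mball x (inverse (real (Suc k))))" for n k
    using compactin_imp_mtotally_bounded[OF K(1)[of n]] by (simp add: mtotally_bounded_def)
  then obtain S where S: "\<And>n k. finite (S n k)" "\<And>n k. S n k \<subseteq> K n"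
    "\<And>n k. K n \<subseteq> (\<Union>x\<in>S n k. mball x (inverse (real (Suc k))))" by metis
  \<comment> \<open>The point \<open>x0\<close> makes \<open>D\<close> visibly nonempty, so that
    \<open>from_nat_into\<close> enumerates exactly \<open>D\<close>.\<close>
  define D where "D = insert x0 (\<Union>n. \<Union>k. S n k)"
  have D: "countable D" "D \<noteq> {}"
    unfolding D_def
    by (intro countable_insert countable_UN[OF countableI_type] countable_finite S(1)) simp
  define x where "x = from_nat_into D"
  have rx: "range x = D" using D by (simp add: x_def)
  have KM: "K n \<subseteq> M" for n using compactin_subset_topspace[OF K(1)] by simp
  have "D \<subseteq> M" using x0 S(2) KM unfolding D_def by blast
  have Ksub: "K n \<subseteq> mtopology closure_of D" for n
  proof
    fix y assume y: "y \<in> K n"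
    have "\<exists>z\<in>D. z \<in> mball y r" if r: "r > 0" for r
    proof -
      obtain k where k: "inverse (real (Suc k)) < r"
        using reals_Archimedean[OF r] by auto
      obtain z where "z \<in> S n k" "y \<in> mball z (inverse (real (Suc k)))" using S(3)[of n k] y by auto
      then show ?thesis using k by (intro bexI[of _ z]) (auto simp: D_def commute)
    qed
    then show "y \<in> mtopology closure_of D"
      using y KM by (auto simp: metric_closure_of)
  qed
  have cl: "mtopology closure_of D \<in> sets p"
    using closedin_in_borel_on[OF closedin_closure_of] p(2) by auto
  have "measure p (mtopology closure_of D) = 1"
  proof (rule antisym)
    show "1 \<le> measure p (mtopology closure_of D)"
    proof (rule LIMSEQ_le_const2)
      show "(\<lambda>n. 1 - 1 / real (Suc n)) \<longlonglongrightarrow> 1"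
        using tendsto_diff[OF tendsto_const LIMSEQ_inverse_real_of_nat, of 1] by (simp add: inverse_eq_divide)
      show "\<exists>N. \<forall>n\<ge>N. 1 - 1 / real (Suc n) \<le> measure p (mtopology closure_of D)"
        using K(2) p.finite_measure_mono[OF Ksub cl] by (meson less_eq_real_def order_trans)
    qed
  qed simp
  then have "AE y in p. y \<in> mtopology closure_of D" by (rule p.AE_prob_1)
  then show ?thesis using that[of x] \<open>D \<subseteq> M\<close> rx by simp
qed

text \<open>The coupling is the joint law, after \<open>g\<close> has been moved on a null set into
  the closure of a sequence so that the pair is Borel. The majorant \<open>h\<close> appears in the
  cost bound because the function d (f w) (g w) of the original variables may not be
  measurable.\<close>

lemma coupling_of_random_variables:
  assumes N: "prob_space N" and f: "f \<in> measurable N (borel_on M d)" and g: "g \<in> measurable N (borel_on M d)"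
    and q: "radon_prob M d (distr N (borel_on M d) g)"
  obtains r where "r \<in> couplings M d (distr N (borel_on M d) f) (distr N (borel_on M d) g)"
    "\<And>h. integrable N h \<Longrightarrow> AE w in N. d (f w) (g w) \<le> h w \<Longrightarrow>
      (\<integral>u. d (fst u) (snd u) \<partial>r) \<le> (\<integral>w. h w \<partial>N)"
proof -
  obtain x :: "nat \<Rightarrow> 'a" where x: "range x \<subseteq> M"
    and ae: "AE y in distr N (borel_on M d) g. y \<in> mtopology closure_of range x"
    using radon_prob_separable[OF q] by metis
  let ?C = "mtopology closure_of range x"
  \<comment> \<open>The fallback \<open>x 0\<close> is taken from the sequence itself, so that
    \<open>g'\<close> never leaves its closure.\<close>
  define g' where "g' w = (if g w \<in> ?C then g w else x 0)" for w
  have C: "?C \<in> sets (borel_on M d)" by (intro closedin_in_borel_on) auto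
  have "{w \<in> space N. g w \<in> ?C} = g -` ?C \<inter> space N" by auto
  then have g': "g' \<in> measurable N (borel_on M d)"
    unfolding g'_def using x measurable_sets[OF g C]
    by (intro measurable_If g measurable_const) auto
  have eq: "AE w in N. g' w = g w"
    using AE_distrD[OF g ae] by eventually_elim (simp add: g'_def)
  have dense: "\<exists>i. d (g' w) (x i) < \<delta>" if "0 < \<delta>" for w \<delta>
  proof (cases "g w \<in> ?C")
    case True
    then show ?thesis using that by (auto simp: g'_def metric_closure_of)
  next
    case False
    then show ?thesis using that x by (intro exI[of _ 0]) (simp add: g'_def range_subsetD)
  qed
  have pair: "(\<lambda>w. (f w, g' w)) \<in> measurable N (borel_on (M \<times> M) (sum_dist d d))"
    using x by (intro pair_measurable[OF Metric_space_axioms f g' dense]) auto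
  define r where "r = distr N (borel_on (M \<times> M) (sum_dist d d)) (\<lambda>w. (f w, g' w))"
  have fs: "fst \<in> measurable (borel_on (M \<times> M) (sum_dist d d)) (borel_on M d)"
      "snd \<in> measurable (borel_on (M \<times> M) (sum_dist d d)) (borel_on M d)"
    by (intro continuous_map_measurable_borel_on Metric_space_sum_self Metric_space_axioms
      continuous_map_fst_snd_sum_dist)+
  have "distr r (borel_on M d) fst = distr N (borel_on M d) f"
    "distr r (borel_on M d) snd = distr N (borel_on M d) g'"
    by (simp_all add: r_def distr_distr[OF fs(1) pair] distr_distr[OF fs(2) pair] comp_def)
  moreover have "distr N (borel_on M d) g' = distr N (borel_on M d) g"
    by (rule distr_cong_AE[OF refl refl eq g' g])
  moreover have "prob_space r"
    unfolding r_def by (rule prob_space.prob_space_distr[OF N pair])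
  ultimately have "r \<in> couplings M d (distr N (borel_on M d) f) (distr N (borel_on M d) g)"
    by (simp add: couplings_def marginals_def r_def)
  moreover have "(\<integral>u. d (fst u) (snd u) \<partial>r) \<le> (\<integral>w. h w \<partial>N)"
    if h: "integrable N h" and le: "AE w in N. d (f w) (g w) \<le> h w" for h
  proof -
    have dm: "(\<lambda>w. d (f w) (g' w)) \<in> borel_measurable N"
      using measurable_compose[OF pair dist_pair_measurable] by simp
    have le': "AE w in N. d (f w) (g' w) \<le> h w" using eq le by eventually_elim simp
    have "(\<integral>u. d (fst u) (snd u) \<partial>r) = (\<integral>w. d (f w) (g' w) \<partial>N)"
      unfolding r_def by (subst integral_distr[OF pair dist_pair_measurable]) simp
    also have "\<dots> \<le> (\<integral>w. h w \<partial>N)"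
    proof (rule integral_mono_AE[OF _ h le'])
      have "AE w in N. norm (d (f w) (g' w)) \<le> norm (h w)"
        using le' by eventually_elim auto
      then show "integrable N (\<lambda>w. d (f w) (g' w))"
        by (rule Bochner_Integration.integrable_bound[OF h dm])
    qed
    finally show ?thesis .
  qed
  ultimately show ?thesis by (rule that)
qed

text \<open>Upper bounds on the distance are obtained in this form from here on: realise both
  measures on one probability space.\<close>

lemma kantorovich_dist_le_random_variables:
  assumes "prob_space N" "f \<in> measurable N (borel_on M d)" "g \<in> measurable N (borel_on M d)"
    and "distr N (borel_on M d) f \<in> kantorovich_space M d" "distr N (borel_on M d) g \<in> kantorovich_space M d"
    and "integrable N h" "AE w in N. d (f w) (g w) \<le> h w"
  shows "kantorovich_dist M d (distr N (borel_on M d) f) (distr N (borel_on M d) g) \<le> (\<integral>w. h w \<partial>N)"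
proof -
  have "radon_prob M d (distr N (borel_on M d) g)" using assms(5) by (simp add: kantorovich_space_def)
  from coupling_of_random_variables[OF assms(1-3) this] obtain r
    where r: "r \<in> couplings M d (distr N (borel_on M d) f) (distr N (borel_on M d) g)"
    "(\<integral>u. d (fst u) (snd u) \<partial>r) \<le> (\<integral>w. h w \<partial>N)" using assms(6,7) by metis
  then show ?thesis using kantorovich_dist_le[OF r(1) assms(4,5)] by linarith
qed

text \<open>The product measure lives on the product of the Borel \<sigma>-algebras, which may be
  too small for a coupling. It serves instead as the probability space on which the two projections
  are random variables.\<close>

lemma couplings_nonempty:
  assumes p: "p \<in> kantorovich_space M d" and q: "q \<in> kantorovich_space M d"
  shows "couplings M d p q \<noteq> {}"
proof -
  interpret p: prob_space p using kantorovich_spaceD(1)[OF p] .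
  interpret q: prob_space q using kantorovich_spaceD(1)[OF q] .
  interpret pq: pair_prob_space p q ..
  have m: "fst \<in> measurable (p \<Otimes>\<^sub>M q) (borel_on M d)" "snd \<in> measurable (p \<Otimes>\<^sub>M q) (borel_on M d)"
    using measurable_fst[of p q] measurable_snd[of p q] kantorovich_spaceD(2)[OF p] kantorovich_spaceD(2)[OF q]
    by (simp_all cong: measurable_cong_sets)
  have 1: "distr (p \<Otimes>\<^sub>M q) (borel_on M d) fst = p"
  proof (rule measure_eqI)
    fix A assume "A \<in> sets (distr (p \<Otimes>\<^sub>M q) (borel_on M d) fst)"
    then have A: "A \<in> sets p" "A \<in> sets (borel_on M d)" using kantorovich_spaceD(2)[OF p] by auto
    have "fst -` A \<inter> space (p \<Otimes>\<^sub>M q) = A \<times> space q"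
      using sets.sets_into_space[OF A(1)] by (auto simp: space_pair_measure)
    then show "emeasure (distr (p \<Otimes>\<^sub>M q) (borel_on M d) fst) A = emeasure p A"
      using A q.emeasure_space_1 by (simp add: emeasure_distr[OF m(1)] q.emeasure_pair_measure_Times)
  qed (simp add: kantorovich_spaceD(2)[OF p])
  have 2: "distr (p \<Otimes>\<^sub>M q) (borel_on M d) snd = q"
  proof (rule measure_eqI)
    fix A assume "A \<in> sets (distr (p \<Otimes>\<^sub>M q) (borel_on M d) snd)"
    then have A: "A \<in> sets q" "A \<in> sets (borel_on M d)" using kantorovich_spaceD(2)[OF q] by auto
    have "snd -` A \<inter> space (p \<Otimes>\<^sub>M q) = space p \<times> A"
      using sets.sets_into_space[OF A(1)] by (auto simp: space_pair_measure)
    then show "emeasure (distr (p \<Otimes>\<^sub>M q) (borel_on M d) snd) A = emeasure q A"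
      using A p.emeasure_space_1 by (simp add: emeasure_distr[OF m(2)] q.emeasure_pair_measure_Times)
  qed (simp add: kantorovich_spaceD(2)[OF q])
  have "radon_prob M d (distr (p \<Otimes>\<^sub>M q) (borel_on M d) snd)"
    using q by (simp add: 2 kantorovich_space_def)
  from coupling_of_random_variables[OF pq.prob_space_axioms m this] show ?thesis
    unfolding 1 2 by blast
qed

lemma abs_integral_diff_le_kantorovich_dist:
  fixes f :: "'a \<Rightarrow> real"
  assumes p: "p \<in> kantorovich_space M d" and q: "q \<in> kantorovich_space M d"
    and f: "\<And>x y. x \<in> M \<Longrightarrow> y \<in> M \<Longrightarrow> \<bar>f x - f y\<bar> \<le> d x y"
  shows "\<bar>(\<integral>x. f x \<partial>p) - (\<integral>x. f x \<partial>q)\<bar> \<le> kantorovich_dist M d p q"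
  by (intro le_kantorovich_dist[OF p q couplings_nonempty[OF p q]] abs_integral_diff_le_coupling[OF p q _ f])

section \<open>The metric axioms\<close>

lemma kantorovich_dist_triangle:
  assumes p: "p \<in> kantorovich_space M d" and q: "q \<in> kantorovich_space M d" and t: "t \<in> kantorovich_space M d"
  shows "kantorovich_dist M d p t \<le> kantorovich_dist M d p q + kantorovich_dist M d q t"
proof (rule field_le_epsilon)
  fix \<epsilon> :: real assume \<epsilon>: "0 < \<epsilon>"
  obtain a where a: "a \<in> couplings M d p q" "(\<integral>u. d (fst u) (snd u) \<partial>a) < kantorovich_dist M d p q + \<epsilon> / 4"
    using kantorovich_dist_less_coupling[OF p q couplings_nonempty[OF p q], of "kantorovich_dist M d p q + \<epsilon> / 4"] \<epsilon> by auto
  obtain b where b: "b \<in> couplings M d q t" "(\<integral>u. d (fst u) (snd u) \<partial>b) < kantorovich_dist M d q t + \<epsilon> / 4"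
    using kantorovich_dist_less_coupling[OF q t couplings_nonempty[OF q t], of "kantorovich_dist M d q t + \<epsilon> / 4"] \<epsilon> by auto
  have "radon_prob M d q" using q by (simp add: kantorovich_space_def)
  then obtain x :: "nat \<Rightarrow> 'a" where x: "range x \<subseteq> M" and ae: "AE y in q. y \<in> mtopology closure_of range x"
    using radon_prob_separable by metis
  \<comment> \<open>Two points of the closure with equal index are less than \<epsilon> / 2 apart.
    Together with the two couplings, each within \<epsilon> / 4 of the infimum, this makes a total
    loss of \<epsilon>.\<close>
  define idx where "idx y = (LEAST n. d (x n) y < \<epsilon> / 4)" for y
  have [measurable]: "(\<lambda>y. d (x n) y) \<in> borel_measurable (borel_on M d)" for n
    using x by (intro dist_measurable) auto
  have idx_meas: "idx \<in> measurable (borel_on M d) (count_space UNIV)"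
    unfolding idx_def by (intro measurable_Least) measurable
  note ma = coupling_marginals[OF a(1)] and mb = coupling_marginals[OF b(1)]
  have same: "distr a (count_space UNIV) (idx \<circ> snd) = distr b (count_space UNIV) (idx \<circ> fst)"
    using distr_distr[OF idx_meas ma(2)] distr_distr[OF idx_meas mb(1)] ma(4) mb(3) by simp
  obtain N where N: "prob_space N" "sets N = sets (a \<Otimes>\<^sub>M b)" "distr N a fst = a" "distr N b snd = b"
      "AE u in N. (idx \<circ> snd) (fst u) = (idx \<circ> fst) (snd u)"
    by (rule discrete_gluing[OF prob_space_coupling[OF a(1)] prob_space_coupling[OF b(1)]
        measurable_comp[OF ma(2) idx_meas] measurable_comp[OF mb(1) idx_meas] same])
  have Nf: "fst \<in> measurable N a" and Ns: "snd \<in> measurable N b"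
    using N(2) by (simp_all cong: measurable_cong_sets)
  have law_p: "distr N (borel_on M d) (\<lambda>u. fst (fst u)) = p"
    using distr_distr[OF ma(1) Nf] N(3) ma(3) by (simp add: comp_def)
  have law_t: "distr N (borel_on M d) (\<lambda>u. snd (snd u)) = t"
    using distr_distr[OF mb(2) Ns] N(4) mb(4) by (simp add: comp_def)
  have law_q1: "distr N (borel_on M d) (\<lambda>u. snd (fst u)) = q"
    using distr_distr[OF ma(2) Nf] N(3) ma(4) by (simp add: comp_def)
  have law_q2: "distr N (borel_on M d) (\<lambda>u. fst (snd u)) = q"
    using distr_distr[OF mb(1) Ns] N(4) mb(3) by (simp add: comp_def)
  define A where "A u = d (fst u) (snd u)" for u
  have Aa: "A \<in> borel_measurable a" and Ab: "A \<in> borel_measurable b"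
    using dist_pair_measurable sets_coupling[OF a(1)] sets_coupling[OF b(1)]
    unfolding A_def by (simp_all cong: measurable_cong_sets)
  have iA: "integrable N (\<lambda>u. A (fst u))" "(\<integral>u. A (fst u) \<partial>N) = (\<integral>u. A u \<partial>a)"
    using integrable_distr_eq[OF Nf Aa] integral_distr[OF Nf Aa] N(3)
      integrable_dist_coupling[OF p q a(1), folded A_def] by simp_all
  have iB: "integrable N (\<lambda>u. A (snd u))" "(\<integral>u. A (snd u) \<partial>N) = (\<integral>u. A u \<partial>b)"
    using integrable_distr_eq[OF Ns Ab] integral_distr[OF Ns Ab] N(4)
      integrable_dist_coupling[OF q t b(1), folded A_def] by simp_all
  have near: "d (x (idx y)) y < \<epsilon> / 4" if "y \<in> mtopology closure_of range x" for y
  proof -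
    have "\<forall>r>0. \<exists>z\<in>range x. z \<in> mball y r" using that by (simp add: metric_closure_of)
    then obtain z where "z \<in> range x" "z \<in> mball y (\<epsilon> / 4)" using \<epsilon> by (meson divide_pos_pos zero_less_numeral)
    then have "\<exists>n. d (x n) y < \<epsilon> / 4" by (metis commute in_mball rangeE)
    then show ?thesis unfolding idx_def by (rule LeastI_ex)
  qed
  have ae1: "AE u in N. snd (fst u) \<in> mtopology closure_of range x"
    using ae unfolding law_q1[symmetric] by (rule AE_distrD[OF measurable_compose[OF Nf ma(2)]])
  have ae2: "AE u in N. fst (snd u) \<in> mtopology closure_of range x"
    using ae unfolding law_q2[symmetric] by (rule AE_distrD[OF measurable_compose[OF Ns mb(1)]])
  \<comment> \<open>The path runs through both copies of the middle point, which are joined via the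
    point of the sequence that carries their common index.\<close>
  have le: "AE u in N. d (fst (fst u)) (snd (snd u)) \<le> A (fst u) + \<epsilon> / 2 + A (snd u)"
    using ae1 ae2 N(5) AE_space
  proof eventually_elim
    case (elim u)
    have sp: "fst u \<in> M \<times> M" "snd u \<in> M \<times> M"
      using elim(4) measurable_space[OF Nf] measurable_space[OF Ns]
        space_coupling[OF a(1)] space_coupling[OF b(1)] by auto
    obtain y1 y2 z1 z2 where [simp]: "u = ((y1, y2), (z1, z2))" by (metis surj_pair)
    have "y1 \<in> M" "y2 \<in> M" "z1 \<in> M" "z2 \<in> M" "x (idx y2) \<in> M" using sp x by auto
    moreover have "d (x (idx y2)) y2 < \<epsilon> / 4" "d (x (idx y2)) z1 < \<epsilon> / 4"
      using near[of y2] near[of z1] elim by auto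
    ultimately show ?case
      using triangle[of y1 y2 z2] triangle[of y2 z1 z2] triangle''[of y2 "x (idx y2)" z1]
      by (simp add: A_def)
  qed
  have "kantorovich_dist M d p t \<le> (\<integral>u. A (fst u) + \<epsilon> / 2 + A (snd u) \<partial>N)"
    using kantorovich_dist_le_random_variables[OF N(1) measurable_compose[OF Nf ma(1)] measurable_compose[OF Ns mb(2)] _ _ _ le]
      iA(1) iB(1) p t N(1) unfolding law_p law_t
    by (simp add: prob_space.prob_space finite_measure.integrable_const prob_space.finite_measure)
  also have "\<dots> = (\<integral>u. A u \<partial>a) + \<epsilon> / 2 + (\<integral>u. A u \<partial>b)"
    using iA iB N(1) prob_space.prob_space[OF N(1)]
    by (simp add: finite_measure.integrable_const prob_space.finite_measure)
  finally show "kantorovich_dist M d p t \<le> kantorovich_dist M d p q + kantorovich_dist M d q t + \<epsilon>"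
    using a(2) b(2) by (simp add: A_def)
qed

lemma kantorovich_dist_commute_le:
  assumes p: "p \<in> kantorovich_space M d" and q: "q \<in> kantorovich_space M d"
  shows "kantorovich_dist M d q p \<le> kantorovich_dist M d p q"
proof (rule le_kantorovich_dist[OF p q couplings_nonempty[OF p q]])
  fix r assume r: "r \<in> couplings M d p q"
  note m = coupling_marginals[OF r]
  have "kantorovich_dist M d (distr r (borel_on M d) snd) (distr r (borel_on M d) fst) \<le> (\<integral>u. d (fst u) (snd u) \<partial>r)"
    using p q integrable_dist_coupling[OF p q r]
    by (intro kantorovich_dist_le_random_variables prob_space_coupling[OF r] m)
      (simp_all add: m commute)
  then show "kantorovich_dist M d q p \<le> (\<integral>u. d (fst u) (snd u) \<partial>r)" by (simp add: m)
qed

lemma kantorovich_dist_refl: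
  assumes p: "p \<in> kantorovich_space M d"
  shows "kantorovich_dist M d p p = 0"
proof (rule antisym)
  have id: "(\<lambda>x. x) \<in> measurable p (borel_on M d)" "distr p (borel_on M d) (\<lambda>x. x) = p"
    using kantorovich_spaceD(2)[OF p] by (simp_all add: distr_id2 cong: measurable_cong_sets)
  have "kantorovich_dist M d (distr p (borel_on M d) (\<lambda>x. x)) (distr p (borel_on M d) (\<lambda>x. x)) \<le> (\<integral>x. 0 \<partial>p)"
    using p by (intro kantorovich_dist_le_random_variables kantorovich_spaceD(1)[OF p] id)
      (auto simp: id kantorovich_spaceD(3)[OF p])
  then show "kantorovich_dist M d p p \<le> 0" by (simp add: id)
  show "0 \<le> kantorovich_dist M d p p"
    by (intro le_kantorovich_dist[OF p p couplings_nonempty[OF p p]]) simp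
qed

lemma Lipschitz_dist_set:
  assumes "x \<in> M" "y \<in> M" "C \<subseteq> M" "C \<noteq> {}"
  shows "\<bar>(INF c\<in>C. d c x) - (INF c\<in>C. d c y)\<bar> \<le> d x y"
proof -
  have *: "(INF c\<in>C. d c x) - d x y \<le> (INF c\<in>C. d c y)" if "x \<in> M" "y \<in> M" for x y
  proof (rule cINF_greatest[OF assms(4)])
    fix c assume c: "c \<in> C"
    have "(INF c\<in>C. d c x) \<le> d c x" by (rule cINF_lower[OF bdd_belowI2[of _ 0] c]) simp
    also have "\<dots> \<le> d c y + d x y" using that c assms by (intro triangle') auto
    finally show "(INF c\<in>C. d c x) - d x y \<le> d c y" by simp
  qed
  show ?thesis using *[OF assms(1,2)] *[OF assms(2,1)] by (simp add: commute abs_le_iff)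
qed

text \<open>Measures at distance 0 integrate Lipschitz functions alike. The truncated multiples
  \<open>F n\<close> of the distance to the complement of an open set tend to its indicator, so the
  measures agree on open sets, an intersection-stable generator.\<close>

lemma kantorovich_dist_eq_0_imp_eq:
  assumes p: "p \<in> kantorovich_space M d" and q: "q \<in> kantorovich_space M d"
    and 0: "kantorovich_dist M d p q = 0"
  shows "p = q"
proof (rule measure_eqI_generator_eq[where E="{U. openin mtopology U}" and \<Omega>=M and A="\<lambda>_. M"])
  interpret p: prob_space p using kantorovich_spaceD(1)[OF p] .
  interpret q: prob_space q using kantorovich_spaceD(1)[OF q] .
  show "Int_stable {U. openin mtopology U}" by (auto simp: Int_stable_def)
  show "{U. openin mtopology U} \<subseteq> Pow M" using openin_subset[of mtopology] by auto
  show "sets p = sigma_sets M {U. openin mtopology U}" "sets q = sigma_sets M {U. openin mtopology U}"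
    using kantorovich_spaceD(2)[OF p] kantorovich_spaceD(2)[OF q] sets_borel_on[OF Metric_space_axioms] by auto
  show "range (\<lambda>_. M) \<subseteq> {U. openin mtopology U}" by auto
  show "(\<Union>i::nat. M) = M" by simp
  show "emeasure p M \<noteq> \<infinity>" by simp
  fix U assume "U \<in> {U. openin mtopology U}"
  then have U: "openin mtopology U" "U \<subseteq> M" using openin_subset[of mtopology] by auto
  show "emeasure p U = emeasure q U"
  \<comment> \<open>For \<open>U = M\<close> the complement is empty and the infimum defining
    \<open>D\<close> would be taken over no points.\<close>
  proof (cases "U = M")
    case True
    then show ?thesis
      using p.emeasure_space_1 q.emeasure_space_1 kantorovich_spaceD(3)[OF p] kantorovich_spaceD(3)[OF q] by simp
  next
    case False
    define D where "D y = (INF c\<in>M - U. d c y)" for y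
    have D: "\<bar>D x - D y\<bar> \<le> d x y" if "x \<in> M" "y \<in> M" for x y
      using Lipschitz_dist_set[OF that, of "M - U"] False U by (auto simp: D_def)
    have D0: "D y \<ge> 0" for y using False U by (auto simp: D_def intro!: cINF_greatest)
    have Dout: "D y = 0" if "y \<in> M - U" for y
    proof -
      have "D y \<le> d y y" unfolding D_def by (rule cINF_lower[OF bdd_belowI2[of _ 0] that]) simp
      then show ?thesis using D0[of y] that by simp
    qed
    have Din: "D y > 0" if y: "y \<in> U" for y
    proof -
      obtain r where r: "r > 0" "mball y r \<subseteq> U" using y U(1) unfolding openin_mtopology by blast
      have "r \<le> D y"
        unfolding D_def
      proof (rule cINF_greatest)
        fix c assume "c \<in> M - U"
        then show "r \<le> d c y" using r(2) y U(2) by (force simp: commute not_less[symmetric])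
      qed (use False U in auto)
      with r(1) show ?thesis by simp
    qed
    define F where "F n y = min 1 (real n * D y)" for n y
    have FL: "\<bar>F n x - F n y\<bar> \<le> real n * d x y" if "x \<in> M" "y \<in> M" for n x y
    proof -
      have "\<bar>F n x - F n y\<bar> \<le> \<bar>real n * D x - real n * D y\<bar>" by (auto simp: F_def)
      also have "\<dots> = real n * \<bar>D x - D y\<bar>" by (simp add: abs_mult flip: right_diff_distrib)
      also have "\<dots> \<le> real n * d x y" by (intro mult_left_mono D that) simp
      finally show ?thesis .
    qed
    \<comment> \<open>Dividing by 1 + n instead of n makes the function 1-Lipschitz for every n,
      zero included.\<close>
    have FL': "\<bar>F n x / (1 + real n) - F n y / (1 + real n)\<bar> \<le> d x y" if "x \<in> M" "y \<in> M" for n x y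
    proof -
      have "\<bar>F n x / (1 + real n) - F n y / (1 + real n)\<bar> = \<bar>F n x - F n y\<bar> / (1 + real n)"
        by (simp add: flip: diff_divide_distrib)
      also have "\<dots> \<le> d x y"
        using FL[OF that, of n] by (simp add: divide_le_eq algebra_simps add_increasing)
      finally show ?thesis .
    qed
    have eqF: "(\<integral>y. F n y \<partial>p) = (\<integral>y. F n y \<partial>q)" for n
      using abs_integral_diff_le_kantorovich_dist[OF p q FL', of n] 0 by simp
    have Fm: "F n \<in> borel_measurable (borel_on M d)" for n
      using Lipschitz_borel_measurable[OF D] unfolding F_def by simp
    have lim: "(\<lambda>n. F n y) \<longlonglongrightarrow> indicator U y" if "y \<in> M" for y
    proof (cases "y \<in> U")
      case True
      obtain n0 where n0: "1 / D y < real n0" using reals_Archimedean2 by auto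
      have "F n y = 1" if "n \<ge> n0" for n
      proof -
        have "1 / D y \<le> real n" using n0 that by (meson le_less_trans less_imp_le of_nat_mono order_less_le_trans)
        then show ?thesis using Din[OF True] by (simp add: F_def min_def divide_le_eq mult.commute)
      qed
      then have "eventually (\<lambda>n. F n y = 1) sequentially" by (auto simp: eventually_sequentially)
      then show ?thesis using True by (simp add: tendsto_eventually)
    qed (use that Dout in \<open>auto simp: F_def\<close>)
    have lim_int: "(\<lambda>n. \<integral>y. F n y \<partial>s) \<longlonglongrightarrow> measure s U"
      if s: "s \<in> kantorovich_space M d" for s
    proof -
      interpret s: prob_space s using kantorovich_spaceD(1)[OF s] .
      have sets: "sets s = sets (borel_on M d)" "space s = M" using kantorovich_spaceD(2,3)[OF s] .
      have Us: "U \<in> sets s" using openin_in_borel_on[OF U(1)] sets by simp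
      have "(\<lambda>n. \<integral>y. F n y \<partial>s) \<longlonglongrightarrow> (\<integral>y. indicator U y \<partial>s)"
      proof (rule integral_dominated_convergence[where w="\<lambda>_. 1"])
        show "\<And>n. F n \<in> borel_measurable s" using Fm sets by (simp cong: measurable_cong_sets)
        show "AE y in s. (\<lambda>n. F n y) \<longlonglongrightarrow> indicator U y" using lim sets by auto
        show "AE y in s. norm (F n y) \<le> 1" for n using D0 by (auto simp: F_def min_def)
      qed (use Us in auto)
      then show ?thesis using Us U(2) sets by (simp add: Int_absorb2)
    qed
    have "measure p U = measure q U"
      using LIMSEQ_unique[OF lim_int[OF p]] lim_int[OF q] eqF by simp
    then show ?thesis by (simp add: p.emeasure_eq_measure q.emeasure_eq_measure)
  qed
qed

theorem Metric_space_kantorovich: "Metric_space (kantorovich_space M d) (kantorovich_dist M d)"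
proof
  fix p q t
  show "0 \<le> kantorovich_dist M d p q"
  proof (cases "p \<in> kantorovich_space M d \<and> q \<in> kantorovich_space M d")
    case True
    then show ?thesis by (intro le_kantorovich_dist couplings_nonempty) auto
  next
    case False
    then show ?thesis unfolding kantorovich_dist_def by auto
  qed
  show "kantorovich_dist M d p q = kantorovich_dist M d q p"
  proof (cases "p \<in> kantorovich_space M d \<and> q \<in> kantorovich_space M d")
    case True
    then show ?thesis by (intro antisym kantorovich_dist_commute_le) auto
  next
    case False
    then show ?thesis unfolding kantorovich_dist_def by auto
  qed
  show "kantorovich_dist M d p q = 0 \<longleftrightarrow> p = q"
    if "p \<in> kantorovich_space M d" "q \<in> kantorovich_space M d"
    using that kantorovich_dist_refl kantorovich_dist_eq_0_imp_eq by blast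
  show "kantorovich_dist M d p t \<le> kantorovich_dist M d p q + kantorovich_dist M d q t"
    if "p \<in> kantorovich_space M d" "q \<in> kantorovich_space M d" "t \<in> kantorovich_space M d"
    using that by (rule kantorovich_dist_triangle)
qed

end

section \<open>Radon measures on complete spaces\<close>

lemma (in finite_measure) measure_UN_geometric_le:
  assumes A: "\<And>k::nat. A k \<in> sets M" and le: "\<And>k. measure M (A k) \<le> \<epsilon> * (1 / 2) ^ Suc k"
  shows "measure M (\<Union>k. A k) \<le> \<epsilon>"
proof -
  have s: "(\<lambda>k. \<epsilon> * (1 / 2 :: real) ^ Suc k) sums (\<epsilon> * 1)"
    by (intro sums_mult power_half_series)
  have sA: "summable (\<lambda>k. measure M (A k))"
    by (rule summable_comparison_test'[OF sums_summable[OF s], of 0]) (use le in auto)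
  have "measure M (\<Union>k. A k) \<le> (\<Sum>k. measure M (A k))"
    using A sA by (intro finite_measure_subadditive_countably) auto
  also have "\<dots> \<le> (\<Sum>k. \<epsilon> * (1 / 2) ^ Suc k)"
    by (intro suminf_le le sA sums_summable[OF s])
  finally show ?thesis using sums_unique[OF s] by simp
qed

lemma (in prob_space) exists_incseq_large:
  assumes A: "range A \<subseteq> events" "incseq A" and full: "AE x in M. x \<in> (\<Union>n. A n)" and \<epsilon>: "0 < \<epsilon>"
  shows "\<exists>n. measure M (space M - A n) \<le> \<epsilon>"
proof -
  have U: "(\<Union>n. A n) \<in> events" using A(1) by auto
  have "(\<lambda>n. prob (A n)) \<longlonglongrightarrow> prob (\<Union>n. A n)" by (rule finite_Lim_measure_incseq[OF A])
  also have "prob (\<Union>n. A n) = 1" using AE_in_set_eq_1[OF U] full by blast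
  finally have "eventually (\<lambda>n. 1 - \<epsilon> < prob (A n)) sequentially" using \<epsilon> by (intro order_tendstoD) auto
  then obtain n where n: "1 - \<epsilon> < prob (A n)" by (auto simp: eventually_sequentially)
  have "A n \<in> events" using A(1) by auto
  then show ?thesis using n by (intro exI[of _ n]) (simp add: prob_compl)
qed

context Metric_space
begin

text \<open>By symmetry of the distance the complement is a union of balls centred outside
  \<open>U\<close>. These sets exhaust \<open>U\<close> from inside by closed sets.\<close>

lemma closedin_inner_parallel:
  assumes U: "openin mtopology U" and r: "0 < r"
  shows "closedin mtopology {x \<in> M. mball x r \<subseteq> U}"
proof -
  have "M - {x \<in> M. mball x r \<subseteq> U} = (\<Union>y\<in>M - U. mball y r)"
    by (auto simp: commute)
  then show ?thesis unfolding closedin_def by auto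
qed

text \<open>The sets that can be squeezed in this way contain the open sets, by exhaustion with
  inner parallel sets, and are closed under complements and countable unions.\<close>

lemma closed_open_approximation:
  assumes p: "prob_space p" "sets p = sets (borel_on M d)" and A: "A \<in> sets p" and \<epsilon>: "0 < \<epsilon>"
  shows "\<exists>C U. closedin mtopology C \<and> openin mtopology U \<and> C \<subseteq> A \<and> A \<subseteq> U \<and> measure p (U - C) \<le> \<epsilon>"
proof -
  interpret p: prob_space p by fact
  have op: "U \<in> sets p" if "openin mtopology U" for U using openin_in_borel_on[OF that] p(2) by simp
  have cl: "C \<in> sets p" if "closedin mtopology C" for C using closedin_in_borel_on[OF that] p(2) by simp
  have "A \<in> sigma_sets M {U. openin mtopology U}"
    using A p(2) sets_borel_on[OF Metric_space_axioms] by simp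
  \<comment> \<open>The error is quantified inside the induction, since the union step needs a
    different one for each set.\<close>
  then have "\<forall>\<epsilon>>0. \<exists>C U. closedin mtopology C \<and> openin mtopology U \<and> C \<subseteq> A \<and> A \<subseteq> U \<and> measure p (U - C) \<le> \<epsilon>"
  proof (induction rule: sigma_sets.induct)
    case (Basic U)
    then have U: "openin mtopology U" by simp
    show ?case
    proof (intro allI impI)
      fix \<epsilon> :: real assume \<epsilon>: "0 < \<epsilon>"
      define C where "C n = {x \<in> M. mball x (inverse (real (Suc n))) \<subseteq> U}" for n
      have C: "closedin mtopology (C n)" for n
        unfolding C_def by (intro closedin_inner_parallel U) simp
      have CU: "C n \<subseteq> U" for n
      proof
        fix x assume "x \<in> C n"
        then have "x \<in> M" "mball x (inverse (real (Suc n))) \<subseteq> U" by (auto simp: C_def)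
        then show "x \<in> U" using centre_in_mball_iff[of x "inverse (real (Suc n))"] by auto
      qed
      have "(\<Inter>n. U - C n) = {}"
      proof -
        have "\<exists>n. x \<in> C n" if x: "x \<in> U" for x
        proof -
          obtain r where r: "r > 0" "mball x r \<subseteq> U" using U x unfolding openin_mtopology by blast
          obtain n where "inverse (real (Suc n)) < r" using reals_Archimedean[OF r(1)] by auto
          then have "mball x (inverse (real (Suc n))) \<subseteq> U"
            using r(2) mball_subset_concentric by (meson less_imp_le order_trans)
          then show ?thesis using x openin_subset[OF U] by (auto simp: C_def)
        qed
        then show ?thesis by auto
      qed
      moreover have "(\<lambda>n. measure p (U - C n)) \<longlonglongrightarrow> measure p (\<Inter>n. U - C n)"
      proof (rule p.finite_Lim_measure_decseq)
        show "range (\<lambda>n. U - C n) \<subseteq> sets p" using op[OF U] cl[OF C] by auto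
        have "C m \<subseteq> C n" if "m \<le> n" for m n
        proof -
          have "inverse (real (Suc n)) \<le> inverse (real (Suc m))" using that by (simp add: le_imp_inverse_le)
          then have "mball x (inverse (real (Suc n))) \<subseteq> mball x (inverse (real (Suc m)))" for x
            by (rule mball_subset_concentric)
          then show ?thesis unfolding C_def by blast
        qed
        then show "decseq (\<lambda>n. U - C n)" unfolding decseq_def by blast
      qed
      ultimately have "(\<lambda>n. measure p (U - C n)) \<longlonglongrightarrow> 0" by (simp only: measure_empty)
      then have "eventually (\<lambda>n. measure p (U - C n) < \<epsilon>) sequentially" using \<epsilon> by (rule order_tendstoD)
      then obtain n where "measure p (U - C n) < \<epsilon>" by (auto simp: eventually_sequentially)
      then show "\<exists>C V. closedin mtopology C \<and> openin mtopology V \<and> C \<subseteq> U \<and> U \<subseteq> V \<and> measure p (V - C) \<le> \<epsilon>"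
        using U C CU by (intro exI[of _ "C n"] exI[of _ U]) auto
    qed
  next
    case Empty
    have "closedin mtopology {} \<and> openin mtopology {} \<and> {} \<subseteq> {} \<and> {} \<subseteq> {} \<and> measure p ({} - {}) \<le> \<epsilon>"
      if "0 < \<epsilon>" for \<epsilon> using that by simp
    then show ?case by (intro allI impI exI) assumption
  next
    case (Compl A)
    show ?case
    proof (intro allI impI)
      fix \<epsilon> :: real assume "0 < \<epsilon>"
      then obtain C U where CU: "closedin mtopology C" "openin mtopology U" "C \<subseteq> A" "A \<subseteq> U" "measure p (U - C) \<le> \<epsilon>"
        using Compl.IH by meson
      have "(M - C) - (M - U) = U - C" using openin_subset[OF CU(2)] by auto
      moreover have "openin mtopology (M - C)" "closedin mtopology (M - U)"
        using CU(1,2) by (metis openin_diff open_in_mspace, metis closedin_diff closedin_mspace)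
      moreover have "M - U \<subseteq> M - A" "M - A \<subseteq> M - C" using CU(3,4) by auto
      ultimately show "\<exists>C U. closedin mtopology C \<and> openin mtopology U \<and> C \<subseteq> M - A \<and> M - A \<subseteq> U \<and> measure p (U - C) \<le> \<epsilon>"
        using CU(5) by (intro exI[of _ "M - U"] exI[of _ "M - C"]) simp
    qed
  next
    case (Union A)
    show ?case
    proof (intro allI impI)
      fix \<epsilon> :: real assume \<epsilon>: "0 < \<epsilon>"
      \<comment> \<open>These errors add up to \<epsilon> / 2. The remaining half pays for cutting
        the union of the closed sets down to the finite union \<open>D n\<close>, which is needed
        for closedness.\<close>
      have "\<exists>C U. closedin mtopology C \<and> openin mtopology U \<and> C \<subseteq> A i \<and> A i \<subseteq> U \<and>
          measure p (U - C) \<le> (\<epsilon> / 2) * (1 / 2) ^ Suc i" for i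
      proof -
        have "0 < (\<epsilon> / 2) * (1 / 2) ^ Suc i" using \<epsilon> by simp
        then show ?thesis using Union.IH[of i] by meson
      qed
      then obtain C U where C: "\<And>i. closedin mtopology (C i)" and U: "\<And>i. openin mtopology (U i)"
        and CA: "\<And>i. C i \<subseteq> A i" and AU: "\<And>i. A i \<subseteq> U i"
        and le: "\<And>i. measure p (U i - C i) \<le> (\<epsilon> / 2) * (1 / 2) ^ Suc i" by metis
      have oU: "openin mtopology (\<Union>i. U i)" using U by blast
      define D where "D n = (\<Union>i\<le>n. C i)" for n
      have D: "closedin mtopology (D n)" for n
        unfolding D_def using C by (intro closedin_Union) auto
      have "measure p (\<Inter>n. (\<Union>i. U i) - D n) \<le> measure p (\<Union>i. U i - C i)"
        using op[OF U] cl[OF C] by (intro p.finite_measure_mono) (fastforce simp: D_def)+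
      also have "\<dots> \<le> \<epsilon> / 2"
        using op[OF U] cl[OF C] le by (intro p.measure_UN_geometric_le) auto
      finally have lt: "measure p (\<Inter>n. (\<Union>i. U i) - D n) < \<epsilon>" using \<epsilon> by linarith
      have "(\<lambda>n. measure p ((\<Union>i. U i) - D n)) \<longlonglongrightarrow> measure p (\<Inter>n. (\<Union>i. U i) - D n)"
      proof (rule p.finite_Lim_measure_decseq)
        show "range (\<lambda>n. (\<Union>i. U i) - D n) \<subseteq> sets p" using op[OF oU] cl[OF D] by auto
        have "D m \<subseteq> D n" if "m \<le> n" for m n using that unfolding D_def by (intro UN_mono) auto
        then show "decseq (\<lambda>n. (\<Union>i. U i) - D n)" unfolding decseq_def by blast
      qed
      from order_tendstoD(2)[OF this lt]
      obtain n where n: "measure p ((\<Union>i. U i) - D n) < \<epsilon>" by (auto simp: eventually_sequentially)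
      have "D n \<subseteq> (\<Union>i. A i)" "(\<Union>i. A i) \<subseteq> (\<Union>i. U i)" using CA AU unfolding D_def by blast+
      then show "\<exists>C V. closedin mtopology C \<and> openin mtopology V \<and> C \<subseteq> (\<Union>i. A i) \<and> (\<Union>i. A i) \<subseteq> V \<and>
          measure p (V - C) \<le> \<epsilon>"
        using D oU n by (intro exI[of _ "D n"] exI[of _ "\<Union>i. U i"]) auto
    qed
  qed
  then show ?thesis using \<epsilon> by blast
qed

text \<open>\<open>mtotally_bounded\<close> wants the centres inside the set. A ball of radius
  \<epsilon> / 2 that meets \<open>S\<close> is contained in the ball of radius \<epsilon> about any
  of its points, so it can be recentred in \<open>S\<close>.\<close>

lemma mtotally_bounded_external:
  assumes "S \<subseteq> M" and net: "\<And>\<epsilon>. 0 < \<epsilon> \<Longrightarrow> \<exists>F. finite F \<and> S \<subseteq> (\<Union>x\<in>F. mball x \<epsilon>)"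
  shows "mtotally_bounded S"
  unfolding mtotally_bounded_def
proof (intro allI impI)
  fix \<epsilon> :: real assume "0 < \<epsilon>"
  then obtain F where F: "finite F" "S \<subseteq> (\<Union>x\<in>F. mball x (\<epsilon> / 2))" using net half_gt_zero by blast
  define c where "c x = (SOME y. y \<in> S \<and> y \<in> mball x (\<epsilon> / 2))" for x
  define F' where "F' = {x \<in> F. \<exists>y. y \<in> S \<and> y \<in> mball x (\<epsilon> / 2)}"
  have c: "c x \<in> S \<and> c x \<in> mball x (\<epsilon> / 2)" if "x \<in> F'" for x
    unfolding c_def by (rule someI_ex) (use that in \<open>auto simp: F'_def\<close>)
  have "S \<subseteq> (\<Union>z\<in>c ` F'. mball z \<epsilon>)"
  proof
    fix y assume y: "y \<in> S"
    then obtain x where x: "x \<in> F" "y \<in> mball x (\<epsilon> / 2)" using F(2) by auto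
    then have x': "x \<in> F'" using y by (auto simp: F'_def)
    have "y \<in> mball (c x) \<epsilon>"
      using c[OF x'] x(2) triangle''[of "c x" x y] by simp
    then show "y \<in> (\<Union>z\<in>c ` F'. mball z \<epsilon>)" using x' by blast
  qed
  moreover have "finite (c ` F')" using F(1) by (simp add: F'_def)
  moreover have "c ` F' \<subseteq> S" using c by auto
  ultimately show "\<exists>K. finite K \<and> K \<subseteq> S \<and> S \<subseteq> (\<Union>x\<in>K. mball x \<epsilon>)"
    by (intro exI[of _ "c ` F'"] conjI)
qed

text \<open>Ulam's theorem. For every k, finitely many closed balls of radius 1 / (k + 1) capture
  all but \<epsilon> / 2 ^ (k + 1) of the mass; the intersection over k is closed and totally
  bounded, hence compact by completeness.\<close>

lemma tight_if_separable:
  assumes mcomplete and p: "prob_space p" "sets p = sets (borel_on M d)"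
    and x: "range x \<subseteq> M" and ae: "AE y in p. y \<in> mtopology closure_of range (x :: nat \<Rightarrow> 'a)" and \<epsilon>: "0 < \<epsilon>"
  shows "\<exists>K. compactin mtopology K \<and> measure p (M - K) \<le> \<epsilon>"
proof -
  interpret p: prob_space p by fact
  have space_p: "space p = M" using sets_eq_imp_space_eq[OF p(2)] by simp
  have cl: "C \<in> sets p" if "closedin mtopology C" for C using closedin_in_borel_on[OF that] p(2) by simp
  define B where "B k n = (\<Union>i\<le>n. mcball (x i) (inverse (real (Suc k))))" for k n
  have Bc: "closedin mtopology (B k n)" for k n
    unfolding B_def by (intro closedin_Union) auto
  have "\<exists>n. measure p (space p - B k n) \<le> \<epsilon> * (1 / 2) ^ Suc k" for k
  proof (rule p.exists_incseq_large)
    show "range (B k) \<subseteq> sets p" using cl[OF Bc] by auto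
    show "incseq (B k)" unfolding incseq_def B_def by (intro allI impI UN_mono) auto
    show "AE y in p. y \<in> (\<Union>n. B k n)"
      using ae
    proof eventually_elim
      case (elim y)
      then have "\<forall>r>0. \<exists>z\<in>range x. z \<in> mball y r" by (simp add: metric_closure_of)
      moreover have "0 < inverse (real (Suc k))" by simp
      ultimately obtain z where z: "z \<in> range x" "z \<in> mball y (inverse (real (Suc k)))" by blast
      then obtain i where i: "z = x i" by auto
      have "y \<in> mcball (x i) (inverse (real (Suc k)))" using z(2) commute[of y z] i by simp
      then show ?case unfolding B_def by blast
    qed
  qed (use \<epsilon> in simp)
  then obtain n where n: "\<And>k. measure p (M - B k (n k)) \<le> \<epsilon> * (1 / 2) ^ Suc k"
    unfolding space_p using choice[of "\<lambda>k n. measure p (M - B k n) \<le> \<epsilon> * (1 / 2) ^ Suc k"] by blast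
  define K where "K = (\<Inter>k. B k (n k))"
  have Kc: "closedin mtopology K" unfolding K_def using Bc by auto
  have "mtotally_bounded K"
  proof (rule mtotally_bounded_external)
    show "K \<subseteq> M" using closedin_subset[OF Kc] by simp
    fix e :: real assume "0 < e"
    then obtain k where k: "inverse (real (Suc k)) < e" using reals_Archimedean by blast
    have "K \<subseteq> B k (n k)" unfolding K_def by auto
    also have "\<dots> \<subseteq> (\<Union>z\<in>x ` {..n k}. mball z e)"
      unfolding B_def UN_simps by (intro UN_mono order_refl mcball_subset_mball_concentric k)
    finally show "\<exists>F. finite F \<and> K \<subseteq> (\<Union>z\<in>F. mball z e)" by (intro exI[of _ "x ` {..n k}"]) auto
  qed
  then have "compactin mtopology K"
    using mtotally_bounded_eq_compact_closure_of[OF \<open>mcomplete\<close>] closure_of_closedin[OF Kc] by simp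
  moreover have "measure p (M - K) \<le> \<epsilon>"
  proof -
    have "M - K = (\<Union>k. M - B k (n k))" unfolding K_def by auto
    also have "measure p \<dots> \<le> \<epsilon>"
      using n sets.compl_sets[OF cl[OF Bc], unfolded space_p] by (intro p.measure_UN_geometric_le)
    finally show ?thesis .
  qed
  ultimately show ?thesis by blast
qed

text \<open>A converse to \<open>radon_prob_separable\<close> on complete spaces. A closed set
  inside \<open>A\<close> that is almost as large, intersected with a compact set of almost full
  measure, is a compact subset of \<open>A\<close>; each of the two losses is at most e / 2.\<close>

lemma radon_prob_if_separable:
  assumes mcomplete and p: "prob_space p" "sets p = sets (borel_on M d)"
    and x: "range x \<subseteq> M" and ae: "AE y in p. y \<in> mtopology closure_of range (x :: nat \<Rightarrow> 'a)"
  shows "radon_prob M d p"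
  unfolding radon_prob_def
proof (intro conjI ballI p)
  interpret p: prob_space p by fact
  have space_p: "space p = M" using sets_eq_imp_space_eq[OF p(2)] by simp
  have cl: "C \<in> sets p" if "closedin mtopology C" for C using closedin_in_borel_on[OF that] p(2) by simp
  fix A assume A: "A \<in> sets p"
  show "emeasure p A = (SUP K\<in>{K. compactin mtopology K \<and> K \<subseteq> A}. emeasure p K)"
  proof (rule antisym)
    show "(SUP K\<in>{K. compactin mtopology K \<and> K \<subseteq> A}. emeasure p K) \<le> emeasure p A"
      using A by (intro SUP_least emeasure_mono) auto
    show "emeasure p A \<le> (SUP K\<in>{K. compactin mtopology K \<and> K \<subseteq> A}. emeasure p K)"
    proof (rule ennreal_le_epsilon)
      fix e :: real assume e: "0 < e"
      obtain C U where CU: "closedin mtopology C" "openin mtopology U" "C \<subseteq> A" "A \<subseteq> U" "measure p (U - C) \<le> e / 2"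
        using closed_open_approximation[OF p A, of "e / 2"] e by auto
      obtain K where K: "compactin mtopology K" "measure p (M - K) \<le> e / 2"
        using tight_if_separable[OF assms(1) p x ae, of "e / 2"] e by auto
      have Kc: "closedin mtopology K" using K(1) Hausdorff_space_mtopology compactin_imp_closedin by blast
      have CK: "compactin mtopology (C \<inter> K)" using closed_Int_compactin[OF CU(1) K(1)] .
      have sets: "C \<inter> K \<in> sets p" "U - C \<in> sets p" "M - K \<in> sets p"
        using cl[OF CU(1)] cl[OF Kc] openin_in_borel_on[OF CU(2)] p(2) sets.compl_sets[OF cl[OF Kc]] space_p by auto
      have "measure p A \<le> measure p ((C \<inter> K) \<union> ((U - C) \<union> (M - K)))"
        using CU openin_subset[OF CU(2)] sets by (intro p.finite_measure_mono) auto
      also have "\<dots> \<le> measure p (C \<inter> K) + measure p ((U - C) \<union> (M - K))"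
        using sets by (intro measure_Un_le) auto
      also have "measure p ((U - C) \<union> (M - K)) \<le> measure p (U - C) + measure p (M - K)"
        using sets by (intro measure_Un_le) auto
      finally have "measure p A \<le> measure p (C \<inter> K) + e" using CU(5) K(2) by linarith
      then have "emeasure p A \<le> emeasure p (C \<inter> K) + ennreal e"
        using e by (simp add: p.emeasure_eq_measure flip: ennreal_plus)
      also have "emeasure p (C \<inter> K) \<le> (SUP K\<in>{K. compactin mtopology K \<and> K \<subseteq> A}. emeasure p K)"
        using CK CU(3) by (intro SUP_upper) auto
      finally show "emeasure p A \<le> (SUP K\<in>{K. compactin mtopology K \<and> K \<subseteq> A}. emeasure p K) + ennreal e"
        by (simp add: add_right_mono)
    qed
  qed
qed

text \<open>For the first moment one base point is enough: a 1-Lipschitz function f is dominated by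
  \<open>\<bar>f a\<bar> + d a y\<close>.\<close>

lemma distr_in_kantorovich_space_if_separable:
  assumes mcomplete and N: "prob_space N" and g: "g \<in> measurable N (borel_on M d)"
    and x: "range x \<subseteq> M" and ae: "AE w in N. g w \<in> mtopology closure_of range (x :: nat \<Rightarrow> 'a)"
    and a: "a \<in> M" and int: "integrable N (\<lambda>w. d a (g w))"
  shows "distr N (borel_on M d) g \<in> kantorovich_space M d"
proof -
  interpret N: prob_space N by fact
  have clm: "mtopology closure_of range x \<in> sets (borel_on M d)"
    by (intro closedin_in_borel_on) auto
  have "AE y in distr N (borel_on M d) g. y \<in> mtopology closure_of range x"
  proof (subst AE_distr_iff[OF g])
    have "{y \<in> space (borel_on M d). y \<in> mtopology closure_of range x} = mtopology closure_of range x"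
      using sets.sets_into_space[OF clm] by auto
    then show "{y \<in> space (borel_on M d). y \<in> mtopology closure_of range x} \<in> sets (borel_on M d)"
      using clm by simp
  qed (rule ae)
  then have "radon_prob M d (distr N (borel_on M d) g)"
    using x by (intro radon_prob_if_separable[OF assms(1)] N.prob_space_distr g) auto
  moreover have "finite_first_moment M d (distr N (borel_on M d) g)"
    unfolding finite_first_moment_def
  proof (intro allI impI)
    fix f :: "'a \<Rightarrow> real" assume f: "\<forall>x\<in>M. \<forall>y\<in>M. \<bar>f x - f y\<bar> \<le> d x y"
    have fm: "f \<in> borel_measurable (borel_on M d)" using f by (intro Lipschitz_borel_measurable) auto
    have "integrable N (\<lambda>w. f (g w))"
    proof (rule Bochner_Integration.integrable_bound)
      show "integrable N (\<lambda>w. \<bar>f a\<bar> + d a (g w))" using int by simp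
      show "(\<lambda>w. f (g w)) \<in> borel_measurable N" by (rule measurable_compose[OF g fm])
      show "AE w in N. norm (f (g w)) \<le> norm (\<bar>f a\<bar> + d a (g w))"
      proof (rule AE_I2)
        fix w assume "w \<in> space N"
        then have "g w \<in> M" using measurable_space[OF g] by simp
        then have "\<bar>f a - f (g w)\<bar> \<le> d a (g w)" using f a by auto
        then show "norm (f (g w)) \<le> norm (\<bar>f a\<bar> + d a (g w))" by simp
      qed
    qed
    then show "integrable (distr N (borel_on M d) g) f"
      using integrable_distr_eq[OF g fm] by simp
  qed
  ultimately show ?thesis by (simp add: kantorovich_space_def)
qed

text \<open>Staying in the open set \<open>U\<close> from some index on does not put the limit into
  \<open>U\<close>, but staying in one of its inner parallel sets does, and this condition is also
  necessary. It is a countable combination of measurable sets.\<close>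

lemma borel_on_measurable_limit:
  assumes f: "\<And>k::nat. f k \<in> measurable N (borel_on M d)"
    and lim: "\<And>w. w \<in> space N \<Longrightarrow> limitin mtopology (\<lambda>k. f k w) (g w) sequentially"
  shows "g \<in> measurable N (borel_on M d)"
  unfolding borel_on_def[of M]
proof (rule measurable_measure_of)
  have gM: "g w \<in> M" if "w \<in> space N" for w using limitin_mspace[OF lim[OF that]] .
  have fM: "f k w \<in> M" if "w \<in> space N" for k w using measurable_space[OF f that] by simp
  show "{U. openin mtopology U} \<subseteq> Pow M" using openin_subset[of mtopology] by auto
  show "g \<in> space N \<rightarrow> M" using gM by auto
  fix U assume "U \<in> {U. openin mtopology U}"
  then have U: "openin mtopology U" by simp
  define C where "C n = {x \<in> M. mball x (inverse (real (Suc n))) \<subseteq> U}" for n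
  have C: "C n \<in> sets (borel_on M d)" for n
    unfolding C_def by (intro closedin_in_borel_on closedin_inner_parallel U) simp
  have near: "\<exists>K. \<forall>k\<ge>K. d (f k w) (g w) < e" if "w \<in> space N" "0 < e" for w e
    using lim[OF that(1)] that(2) by (fastforce simp: limitin_metric eventually_sequentially)
  have "g -` U \<inter> space N = (\<Union>n. \<Union>K. \<Inter>k\<in>{K..}. f k -` C n \<inter> space N)" (is "?L = ?R")
  proof (intro equalityI subsetI)
    fix w assume w: "w \<in> ?L"
    then obtain r where r: "r > 0" "mball (g w) r \<subseteq> U" using U unfolding openin_mtopology by blast
    obtain n where n: "inverse (real (Suc n)) < r / 2" using reals_Archimedean[of "r / 2"] r by auto
    obtain K where K: "\<forall>k\<ge>K. d (f k w) (g w) < r / 2" using near[of w "r / 2"] w r by auto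
    have "f k w \<in> C n" if "k \<ge> K" for k
    proof -
      have "mball (f k w) (inverse (real (Suc n))) \<subseteq> mball (g w) r"
        using K n that w gM by (intro mball_subset) auto
      then show ?thesis using r(2) fM w by (auto simp: C_def)
    qed
    then show "w \<in> ?R" using w by blast
  next
    fix w assume "w \<in> ?R"
    then obtain n K where w: "w \<in> space N" "\<forall>k\<ge>K. f k w \<in> C n" by auto
    obtain K' where K': "\<forall>k\<ge>K'. d (f k w) (g w) < inverse (real (Suc n))"
      using near[OF w(1), of "inverse (real (Suc n))"] by auto
    have "g w \<in> mball (f (max K K') w) (inverse (real (Suc n)))"
      using K' w(1) fM gM by auto
    moreover have "f (max K K') w \<in> C n" using w(2) by simp
    ultimately show "w \<in> ?L" using w(1) unfolding C_def by blast
  qed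
  also have "\<dots> \<in> sets N"
    using measurable_sets[OF f C] by (intro sets.countable_nat_UN image_subsetI sets.countable_INT') auto
  finally show "g -` U \<inter> space N \<in> sets N" .
qed

end

lemma mcomplete_sum_dist:
  assumes X: "Metric_space X d" "Metric_space.mcomplete X d" and Y: "Metric_space Y e" "Metric_space.mcomplete Y e"
  shows "Metric_space.mcomplete (X \<times> Y) (sum_dist d e)"
proof -
  interpret X: Metric_space X d by fact
  interpret Y: Metric_space Y e by fact
  interpret S: Metric_space "X \<times> Y" "sum_dist d e" by (intro Metric_space_sum_dist X Y)
  show ?thesis
    unfolding S.mcomplete_def
  proof (intro allI impI)
    fix s assume s: "S.MCauchy s"
    have sum: "sum_dist d e u v = d (fst u) (fst v) + e (snd u) (snd v)" for u v
      by (cases u; cases v) simp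
    have le: "d (fst u) (fst v) \<le> sum_dist d e u v" "e (snd u) (snd v) \<le> sum_dist d e u v" for u v
      by (simp_all add: sum)
    have ran: "s n \<in> X \<times> Y" for n using s by (auto simp: S.MCauchy_def)
    have "X.MCauchy (\<lambda>n. fst (s n))"
      unfolding X.MCauchy_def
    proof (intro conjI allI impI)
      show "range (\<lambda>n. fst (s n)) \<subseteq> X" using ran by (auto simp: mem_Times_iff)
      fix \<epsilon> :: real assume "0 < \<epsilon>"
      then obtain N where "\<forall>n n'. N \<le> n \<longrightarrow> N \<le> n' \<longrightarrow> sum_dist d e (s n) (s n') < \<epsilon>"
        using s unfolding S.MCauchy_def by blast
      then show "\<exists>N. \<forall>n n'. N \<le> n \<longrightarrow> N \<le> n' \<longrightarrow> d (fst (s n)) (fst (s n')) < \<epsilon>"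
        using le(1) by (meson order_le_less_trans)
    qed
    then obtain a where a: "limitin X.mtopology (\<lambda>n. fst (s n)) a sequentially"
      using X(2) unfolding X.mcomplete_def by blast
    have "Y.MCauchy (\<lambda>n. snd (s n))"
      unfolding Y.MCauchy_def
    proof (intro conjI allI impI)
      show "range (\<lambda>n. snd (s n)) \<subseteq> Y" using ran by (auto simp: mem_Times_iff)
      fix \<epsilon> :: real assume "0 < \<epsilon>"
      then obtain N where "\<forall>n n'. N \<le> n \<longrightarrow> N \<le> n' \<longrightarrow> sum_dist d e (s n) (s n') < \<epsilon>"
        using s unfolding S.MCauchy_def by blast
      then show "\<exists>N. \<forall>n n'. N \<le> n \<longrightarrow> N \<le> n' \<longrightarrow> e (snd (s n)) (snd (s n')) < \<epsilon>"
        using le(2) by (meson order_le_less_trans)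
    qed
    then obtain b where b: "limitin Y.mtopology (\<lambda>n. snd (s n)) b sequentially"
      using Y(2) unfolding Y.mcomplete_def by blast
    have "limitin S.mtopology s (a, b) sequentially"
      unfolding S.limitin_metric_dist_null
    proof (intro conjI)
      show "(a, b) \<in> X \<times> Y" using X.limitin_mspace[OF a] Y.limitin_mspace[OF b] by simp
      show "eventually (\<lambda>n. s n \<in> X \<times> Y) sequentially" using ran by simp
      show "(\<lambda>n. sum_dist d e (s n) (a, b)) \<longlonglongrightarrow> 0"
        using tendsto_add[of "\<lambda>n. d (fst (s n)) a" 0 sequentially "\<lambda>n. e (snd (s n)) b" 0] a b
        unfolding X.limitin_metric_dist_null Y.limitin_metric_dist_null by (simp add: sum)
    qed
    then show "\<exists>l. limitin S.mtopology s l sequentially" by blast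
  qed
qed

section \<open>Approximation by finite sets\<close>

context Metric_space
begin

text \<open>The bound refers to a given coupling and not to the distance of \<open>p\<close> and
  \<open>q\<close>, so that the bounds for both projections can be added under the same
  integral.\<close>

lemma kantorovich_dist_distr_le:
  assumes Y: "Metric_space Y e"
    and f: "\<And>x. x \<in> M \<Longrightarrow> f x \<in> Y" "\<And>x y. x \<in> M \<Longrightarrow> y \<in> M \<Longrightarrow> e (f x) (f y) \<le> d x y"
    and p: "p \<in> kantorovich_space M d" and q: "q \<in> kantorovich_space M d" and r: "r \<in> couplings M d p q"
  shows "integrable r (\<lambda>u. e (f (fst u)) (f (snd u)))"
    and "kantorovich_dist Y e (distr p (borel_on Y e) f) (distr q (borel_on Y e) f)
      \<le> (\<integral>u. e (f (fst u)) (f (snd u)) \<partial>r)"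
proof -
  interpret Y: Metric_space Y e by fact
  note m = coupling_marginals[OF r]
  have fm: "f \<in> measurable (borel_on M d) (borel_on Y e)"
    by (intro continuous_map_measurable_borel_on nonexpansive_continuous_map Metric_space_axioms Y f)
  have ff: "(\<lambda>u. (f (fst u), f (snd u))) \<in> measurable (borel_on (M \<times> M) (sum_dist d d)) (borel_on (Y \<times> Y) (sum_dist e e))"
  proof (intro continuous_map_measurable_borel_on nonexpansive_continuous_map Metric_space_sum_self Y.Metric_space_sum_self)
    fix u v assume "u \<in> M \<times> M" "v \<in> M \<times> M"
    then show "(f (fst u), f (snd u)) \<in> Y \<times> Y"
      "sum_dist e e (f (fst u), f (snd u)) (f (fst v), f (snd v)) \<le> sum_dist d d u v"
      using f by (auto simp: mem_Times_iff sum_dist_def case_prod_beta intro!: add_mono)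
  qed
  show i: "integrable r (\<lambda>u. e (f (fst u)) (f (snd u)))"
  proof (rule Bochner_Integration.integrable_bound[OF integrable_dist_coupling[OF p q r]])
    show "(\<lambda>u. e (f (fst u)) (f (snd u))) \<in> borel_measurable r"
      using measurable_compose[OF ff Y.dist_pair_measurable] sets_coupling[OF r] by (simp cong: measurable_cong_sets)
    show "AE u in r. norm (e (f (fst u)) (f (snd u))) \<le> norm (d (fst u) (snd u))"
      by (rule AE_I2) (use f(2) space_coupling[OF r] in \<open>auto simp: mem_Times_iff\<close>)
  qed
  have laws: "distr r (borel_on Y e) (\<lambda>u. f (fst u)) = distr p (borel_on Y e) f"
    "distr r (borel_on Y e) (\<lambda>u. f (snd u)) = distr q (borel_on Y e) f"
    using distr_distr[OF fm m(1)] distr_distr[OF fm m(2)] by (simp_all add: m comp_def)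
  have "kantorovich_dist Y e (distr r (borel_on Y e) (\<lambda>u. f (fst u))) (distr r (borel_on Y e) (\<lambda>u. f (snd u)))
      \<le> (\<integral>u. e (f (fst u)) (f (snd u)) \<partial>r)"
    using distr_in_kantorovich_space[OF Metric_space_axioms Y f p] distr_in_kantorovich_space[OF Metric_space_axioms Y f q]
    by (intro Y.kantorovich_dist_le_random_variables prob_space_coupling[OF r] measurable_compose[OF m(1) fm]
        measurable_compose[OF m(2) fm] i) (simp_all add: laws)
  then show "kantorovich_dist Y e (distr p (borel_on Y e) f) (distr q (borel_on Y e) f)
      \<le> (\<integral>u. e (f (fst u)) (f (snd u)) \<partial>r)" by (simp add: laws)
qed

lemma dist_set_measurable:
  assumes "S \<subseteq> M" "S \<noteq> {}"
  shows "(\<lambda>y. INF s\<in>S. d s y) \<in> borel_measurable (borel_on M d)"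
  by (intro Lipschitz_borel_measurable Lipschitz_dist_set assms)

lemma dist_set_nonneg: "S \<noteq> {} \<Longrightarrow> 0 \<le> (INF s\<in>S. d s y)"
  by (intro cINF_greatest) auto

lemma dist_set_le: "s \<in> S \<Longrightarrow> (INF s\<in>S. d s y) \<le> d s y"
  by (rule cINF_lower[OF bdd_belowI2[of _ 0]]) simp

lemma integrable_dist_set:
  assumes p: "p \<in> kantorovich_space M d" and "S \<subseteq> M" "S \<noteq> {}"
  shows "integrable p (\<lambda>y. INF s\<in>S. d s y)"
  by (intro kantorovich_spaceD(4)[OF p] Lipschitz_dist_set assms)

text \<open>Take initial segments of a sequence whose closure has full measure. Their distance
  functions tend to 0 almost everywhere and lie below d (x 0) y, which the finite first moment makes
  integrable.\<close>

lemma finite_set_approximation: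
  assumes p: "p \<in> kantorovich_space M d" and \<epsilon>: "0 < \<epsilon>"
  obtains S where "finite S" "S \<noteq> {}" "S \<subseteq> M" "(\<integral>y. (INF s\<in>S. d s y) \<partial>p) < \<epsilon>"
proof -
  have "radon_prob M d p" using p by (simp add: kantorovich_space_def)
  then obtain x :: "nat \<Rightarrow> 'a" where x: "range x \<subseteq> M" and ae: "AE y in p. y \<in> mtopology closure_of range x"
    by (rule radon_prob_separable)
  define S where "S n = x ` {..n}" for n
  have S: "finite (S n)" "S n \<noteq> {}" "S n \<subseteq> M" for n using x by (auto simp: S_def)
  have "(\<lambda>n. \<integral>y. (INF s\<in>S n. d s y) \<partial>p) \<longlonglongrightarrow> (\<integral>y. 0 \<partial>p)"
  proof (rule integral_dominated_convergence[where w="\<lambda>y. d (x 0) y"])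
    show "integrable p (\<lambda>y. d (x 0) y)" using x by (intro integrable_dist p) auto
    show "(\<lambda>y. INF s\<in>S n. d s y) \<in> borel_measurable p" for n
      using dist_set_measurable[OF S(3,2)] kantorovich_spaceD(2)[OF p] by (simp cong: measurable_cong_sets)
    show "AE y in p. norm (INF s\<in>S n. d s y) \<le> d (x 0) y" for n
    proof (rule AE_I2)
      fix y
      have "x 0 \<in> S n" by (auto simp: S_def)
      from dist_set_le[OF this, of y] dist_set_nonneg[OF S(2)[of n], of y]
      show "norm (INF s\<in>S n. d s y) \<le> d (x 0) y" by simp
    qed
    show "AE y in p. (\<lambda>n. INF s\<in>S n. d s y) \<longlonglongrightarrow> 0"
      using ae
    proof eventually_elim
      case (elim y)
      show ?case
      proof (rule LIMSEQ_I)
        fix e :: real assume e: "0 < e"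
        have "\<forall>r>0. \<exists>z\<in>range x. z \<in> mball y r" using elim by (simp add: metric_closure_of)
        then obtain z where z: "z \<in> range x" "z \<in> mball y e" using e by blast
        then obtain k where k: "z = x k" by auto
        have "norm ((INF s\<in>S n. d s y) - 0) < e" if "k \<le> n" for n
        proof -
          have "x k \<in> S n" using that by (auto simp: S_def)
          from dist_set_le[OF this, of y] dist_set_nonneg[OF S(2)[of n], of y] z(2)
          show ?thesis by (simp add: k commute)
        qed
        then show "\<exists>k. \<forall>n\<ge>k. norm ((INF s\<in>S n. d s y) - 0) < e" by blast
      qed
    qed
  qed simp
  then have "(\<lambda>n. \<integral>y. (INF s\<in>S n. d s y) \<partial>p) \<longlonglongrightarrow> 0" by simp
  from order_tendstoD(2)[OF this \<epsilon>] obtain n where "(\<integral>y. (INF s\<in>S n. d s y) \<partial>p) < \<epsilon>"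
    by (auto simp: eventually_sequentially)
  then show ?thesis by (rule that[OF S])
qed

lemma dist_set_antimono:
  assumes "S \<subseteq> T" "S \<noteq> {}"
  shows "(INF s\<in>T. d s y) \<le> (INF s\<in>S. d s y)"
  by (intro cINF_superset_mono bdd_belowI2[of _ 0] assms) auto

text \<open>This plays the role of uniform tightness in Prokhorov's theorem.\<close>

lemma compactin_kantorovich_finite_approximation:
  assumes K: "compactin (Metric_space.mtopology (kantorovich_space M d) (kantorovich_dist M d)) K" "K \<noteq> {}"
    and \<epsilon>: "0 < \<epsilon>"
  obtains S where "finite S" "S \<noteq> {}" "S \<subseteq> M" "\<And>p. p \<in> K \<Longrightarrow> (\<integral>y. (INF s\<in>S. d s y) \<partial>p) \<le> \<epsilon>"
proof -
  interpret P: Metric_space "kantorovich_space M d" "kantorovich_dist M d" by (rule Metric_space_kantorovich)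
  have KP: "K \<subseteq> kantorovich_space M d" using compactin_subset_topspace[OF K(1)] by simp
  have "P.mtotally_bounded K" using P.compactin_imp_mtotally_bounded[OF K(1)] .
  \<comment> \<open>Half of \<epsilon> is spent on moving from a measure to the net
    \<open>F\<close>, the other half on the finite set that serves its neighbour in the net.\<close>
  then obtain F where F: "finite F" "F \<subseteq> K" "K \<subseteq> (\<Union>p\<in>F. P.mball p (\<epsilon> / 2))"
    using \<epsilon> unfolding P.mtotally_bounded_def by (meson half_gt_zero)
  have "\<exists>S. finite S \<and> S \<noteq> {} \<and> S \<subseteq> M \<and> (\<integral>y. (INF s\<in>S. d s y) \<partial>p) < \<epsilon> / 2" if "p \<in> F" for p
  proof -
    have pP: "p \<in> kantorovich_space M d" using that F(2) KP by auto
    have e2: "0 < \<epsilon> / 2" using \<epsilon> by simp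
    show ?thesis by (rule finite_set_approximation[OF pP e2]) (intro exI conjI)
  qed
  then obtain S where S: "\<And>p. p \<in> F \<Longrightarrow> finite (S p)" "\<And>p. p \<in> F \<Longrightarrow> S p \<noteq> {}" "\<And>p. p \<in> F \<Longrightarrow> S p \<subseteq> M"
      "\<And>p. p \<in> F \<Longrightarrow> (\<integral>y. (INF s\<in>S p. d s y) \<partial>p) < \<epsilon> / 2"
    by metis
  define T where "T = (\<Union>p\<in>F. S p)"
  obtain p0 where "p0 \<in> F" using F(3) K(2) by auto
  then have T: "finite T" "T \<noteq> {}" "T \<subseteq> M" using F(1) S(1-3) by (auto simp: T_def)
  have "(\<integral>y. (INF s\<in>T. d s y) \<partial>p) \<le> \<epsilon>" if p: "p \<in> K" for p
  proof -
    obtain q where q: "q \<in> F" "p \<in> P.mball q (\<epsilon> / 2)" using F(3) p by auto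
    then have qP: "q \<in> kantorovich_space M d" "p \<in> kantorovich_space M d" "kantorovich_dist M d q p < \<epsilon> / 2"
      by (auto simp: P.in_mball)
    have "(\<integral>y. (INF s\<in>T. d s y) \<partial>p) \<le> (\<integral>y. (INF s\<in>T. d s y) \<partial>q) + \<epsilon> / 2"
      using abs_integral_diff_le_kantorovich_dist[OF qP(1,2) Lipschitz_dist_set[OF _ _ T(3,2)]] qP(3) by linarith
    also have "(\<integral>y. (INF s\<in>T. d s y) \<partial>q) \<le> (\<integral>y. (INF s\<in>S q. d s y) \<partial>q)"
      using q(1) S by (intro integral_mono integrable_dist_set qP T dist_set_antimono) (auto simp: T_def)
    finally show ?thesis using S(4)[OF q(1)] by linarith
  qed
  with T show ?thesis by (rule that)
qed

end

text \<open>A coupling of two measures induces couplings of both pairs of marginals, and the two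
  induced costs sum exactly to its own. Bounding the two distances separately would lose a factor
  2.\<close>

lemma continuous_map_marginals:
  assumes X: "Metric_space X d" and Y: "Metric_space Y e"
  shows "continuous_map
    (Metric_space.mtopology (kantorovich_space (X \<times> Y) (sum_dist d e)) (kantorovich_dist (X \<times> Y) (sum_dist d e)))
    (Metric_space.mtopology (kantorovich_space X d \<times> kantorovich_space Y e)
      (sum_dist (kantorovich_dist X d) (kantorovich_dist Y e))) (marginals X d Y e)"
proof -
  interpret X: Metric_space X d by fact
  interpret Y: Metric_space Y e by fact
  interpret S: Metric_space "X \<times> Y" "sum_dist d e" by (intro Metric_space_sum_dist X Y)
  show ?thesis
  proof (intro nonexpansive_continuous_map S.Metric_space_kantorovich Metric_space_sum_dist
      X.Metric_space_kantorovich Y.Metric_space_kantorovich)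
    fix r assume r: "r \<in> kantorovich_space (X \<times> Y) (sum_dist d e)"
    show "marginals X d Y e r \<in> kantorovich_space X d \<times> kantorovich_space Y e"
      using marginals_in_kantorovich_space[OF X Y] r by auto
    fix r' assume r': "r' \<in> kantorovich_space (X \<times> Y) (sum_dist d e)"
    show "sum_dist (kantorovich_dist X d) (kantorovich_dist Y e) (marginals X d Y e r) (marginals X d Y e r')
        \<le> kantorovich_dist (X \<times> Y) (sum_dist d e) r r'"
    proof (rule S.le_kantorovich_dist[OF r r' S.couplings_nonempty[OF r r']])
      fix c assume c: "c \<in> couplings (X \<times> Y) (sum_dist d e) r r'"
      have f: "\<And>u. u \<in> X \<times> Y \<Longrightarrow> fst u \<in> X" "\<And>u v. d (fst u) (fst v) \<le> sum_dist d e u v"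
        and s: "\<And>u. u \<in> X \<times> Y \<Longrightarrow> snd u \<in> Y" "\<And>u v. e (snd u) (snd v) \<le> sum_dist d e u v"
        and sum: "\<And>u v. sum_dist d e u v = d (fst u) (fst v) + e (snd u) (snd v)"
        by (auto simp: sum_dist_def case_prod_beta)
      note 1 = S.kantorovich_dist_distr_le[OF X f r r' c] and 2 = S.kantorovich_dist_distr_le[OF Y s r r' c]
      have "sum_dist (kantorovich_dist X d) (kantorovich_dist Y e) (marginals X d Y e r) (marginals X d Y e r')
        \<le> (\<integral>u. d (fst (fst u)) (fst (snd u)) \<partial>c) + (\<integral>u. e (snd (fst u)) (snd (snd u)) \<partial>c)"
        using 1(2) 2(2) by (simp add: marginals_def)
      also have "\<dots> = (\<integral>u. sum_dist d e (fst u) (snd u) \<partial>c)"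
        using 1(1) 2(1) by (simp add: sum)
      finally show "sum_dist (kantorovich_dist X d) (kantorovich_dist Y e) (marginals X d Y e r) (marginals X d Y e r')
        \<le> (\<integral>u. sum_dist d e (fst u) (snd u) \<partial>c)" .
    qed
  qed
qed

section \<open>Coding by points of the Cantor set\<close>

text \<open>With digits 0 and 2 in base 3, sequences differing in the first digit lie on opposite
  sides of the gap between 1/3 and 2/3. Binary expansions have no such gap, and their digits do not
  depend continuously on the number.\<close>

definition ternary :: "(nat \<Rightarrow> bool) \<Rightarrow> real"
  where "ternary b = (\<Sum>n. (if b n then 2 else 0) / 3 ^ Suc n)"

text \<open>\<open>ternary_digit\<close> is meant for elements of the Cantor set; the values elsewhere are irrelevant.\<close>

primrec ternary_digit :: "nat \<Rightarrow> real \<Rightarrow> bool"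
  where "ternary_digit 0 y \<longleftrightarrow> 1 / 2 \<le> y"
  | "ternary_digit (Suc n) y \<longleftrightarrow> ternary_digit n (3 * y - (if 1 / 2 \<le> y then 2 else 0))"

lemma geometric_third: "(\<lambda>n. 2 / 3 ^ Suc n :: real) sums 1"
  using sums_mult[OF geometric_sums[of "1 / 3 :: real"], of "2 / 3"] by (simp add: power_divide)

lemma summable_ternary: "summable (\<lambda>n. (if b n then 2 else 0) / 3 ^ Suc n :: real)"
  by (rule summable_comparison_test'[OF sums_summable[OF geometric_third], of 0]) (auto simp: divide_right_mono)

lemma ternary_nonneg: "0 \<le> ternary b"
  unfolding ternary_def by (intro suminf_nonneg summable_ternary) auto

lemma ternary_le_1: "ternary b \<le> 1"
proof -
  have "ternary b \<le> (\<Sum>n. 2 / 3 ^ Suc n)"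
    unfolding ternary_def by (intro suminf_le summable_ternary sums_summable[OF geometric_third]) (auto simp: divide_right_mono)
  then show ?thesis using sums_unique[OF geometric_third] by simp
qed

text \<open>The self-similarity of the Cantor set, which drives the inductions on the digit
  position.\<close>

lemma ternary_shift: "3 * ternary b - (if b 0 then 2 else 0) = ternary (\<lambda>n. b (Suc n))"
proof -
  have "3 * ternary b = (\<Sum>n. 3 * ((if b n then 2 else 0) / 3 ^ Suc n))"
    unfolding ternary_def by (rule suminf_mult[OF summable_ternary, symmetric])
  also have "\<dots> = (\<Sum>n. 3 * ((if b (Suc n) then 2 else 0) / 3 ^ Suc (Suc n))) + (if b 0 then 2 else 0)"
    using suminf_split_head[OF summable_mult[OF summable_ternary, of 3 b]] by simp
  finally show ?thesis by (simp add: ternary_def)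
qed

lemma ternary_ge_half_iff: "1 / 2 \<le> ternary b \<longleftrightarrow> b 0"
  using ternary_shift[of b] ternary_nonneg[of "\<lambda>n. b (Suc n)"] ternary_le_1[of "\<lambda>n. b (Suc n)"] by (cases "b 0") auto

lemma ternary_digit_ternary: "ternary_digit i (ternary b) = b i"
proof (induction i arbitrary: b)
  case 0
  show ?case using ternary_ge_half_iff[of b] by simp
next
  case (Suc i)
  have "3 * ternary b - (if 1 / 2 \<le> ternary b then 2 else 0) = ternary (\<lambda>n. b (Suc n))"
    using ternary_shift[of b] by (simp only: ternary_ge_half_iff)
  then show ?case using Suc by (simp only: ternary_digit.simps)
qed

lemma ternary_digit_measurable [measurable]: "Measurable.pred borel (ternary_digit i)"
proof (induction i)
  case 0
  show ?case by simp
next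
  case (Suc i)
  have "(\<lambda>y::real. 3 * y - (if 1 / 2 \<le> y then 2 else 0)) \<in> borel_measurable borel" by measurable
  from measurable_compose[OF this Suc] show ?case by simp
qed

lemma ternary_measurable:
  assumes [measurable]: "\<And>i. Measurable.pred N (b i)"
  shows "(\<lambda>w. ternary (\<lambda>i. b i w)) \<in> borel_measurable N"
  unfolding ternary_def by measurable

lemma eventually_first_ternary_digit:
  assumes "(\<lambda>j. ternary (b j)) \<longlonglongrightarrow> L"
  shows "eventually (\<lambda>j. b j 0 = (1 / 2 \<le> L)) sequentially"
proof (cases "1 / 2 \<le> L")
  case True
  \<comment> \<open>The closed condition is weakened to an open one, which passes to nearby terms;
    because of the gap it still forces the first digit.\<close>
  then have "1 / 3 < L" by simp
  from order_tendstoD(1)[OF assms this] show ?thesis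
  proof eventually_elim
    case (elim j)
    have "b j 0"
    proof (rule ccontr)
      assume "\<not> b j 0"
      then show False using ternary_shift[of "b j"] ternary_le_1[of "\<lambda>n. b j (Suc n)"] elim by simp
    qed
    then show ?case using True by simp
  qed
next
  case False
  then have "L < 1 / 2" by simp
  from order_tendstoD(2)[OF assms this] show ?thesis
  proof eventually_elim
    case (elim j)
    then show ?case using False ternary_ge_half_iff[of "b j"] by auto
  qed
qed

lemma eventually_ternary_digit:
  assumes "(\<lambda>j. ternary (b j)) \<longlonglongrightarrow> L"
  shows "eventually (\<lambda>j. b j i = ternary_digit i L) sequentially"
  using assms
proof (induction i arbitrary: b L)
  case (0 b L)
  then show ?case using eventually_first_ternary_digit by simp
next
  case (Suc i b L)
  have ev: "eventually (\<lambda>j. 3 * ternary (b j) - (if 1 / 2 \<le> L then 2 else 0) = ternary (\<lambda>n. b j (Suc n))) sequentially"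
    using eventually_first_ternary_digit[OF Suc.prems]
  proof eventually_elim
    case (elim j)
    then show ?case using ternary_shift[of "b j"] by simp
  qed
  have "(\<lambda>j. 3 * ternary (b j) - (if 1 / 2 \<le> L then 2 else 0)) \<longlonglongrightarrow> 3 * L - (if 1 / 2 \<le> L then 2 else 0)"
    by (intro tendsto_intros Suc.prems)
  then have "(\<lambda>j. ternary (\<lambda>n. b j (Suc n))) \<longlonglongrightarrow> 3 * L - (if 1 / 2 \<le> L then 2 else 0)"
    by (rule Lim_transform_eventually[OF _ ev])
  from Suc.IH[OF this] show ?case by simp
qed

text \<open>
  The sequence of codes of a point is packed into a point of the Cantor set, so that Helly's selection
  theorem and Skorohod's theorem on the real line apply; digits are locally constant on the Cantor set.
\<close>

lemma finite_codes_subsequence: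
  fixes p :: "nat \<Rightarrow> 'a measure" and c :: "nat \<Rightarrow> 'a \<Rightarrow> nat"
  assumes p: "\<And>n. prob_space (p n)" "\<And>n. sets (p n) = sets A"
    and c: "\<And>k. c k \<in> measurable A (count_space UNIV)" and m: "\<And>k z. z \<in> space A \<Longrightarrow> c k z \<le> m k"
  obtains r :: "nat \<Rightarrow> nat" and \<Omega> :: "real measure" and C :: "nat \<Rightarrow> nat \<Rightarrow> real \<Rightarrow> nat" and C' :: "nat \<Rightarrow> real \<Rightarrow> nat"
  where "strict_mono r" "prob_space \<Omega>"
    "\<And>j k. C j k \<in> measurable \<Omega> (count_space UNIV)" "\<And>k. C' k \<in> measurable \<Omega> (count_space UNIV)"
    "\<And>j k l. distr \<Omega> (count_space UNIV) (\<lambda>w. (C j k w, C j l w)) =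
      distr (p (r j)) (count_space UNIV) (\<lambda>z. (c k z, c l z))"
    "AE w in \<Omega>. \<forall>k. eventually (\<lambda>j. C j k w = C' k w) sequentially"
proof -
  \<comment> \<open>One-hot encoding: the bit at position (k, i) records whether the k-th code
    equals i.\<close>
  define b where "b n z = (c (fst (prod_decode n)) z = snd (prod_decode n))" for n z
  have bm: "Measurable.pred A (b n)" for n
    unfolding b_def using c[measurable] by measurable
  define code where "code z = ternary (\<lambda>n. b n z)" for z
  have codeA: "code \<in> borel_measurable A" unfolding code_def by (rule ternary_measurable[OF bm])
  have sp: "space (p n) = space A" for n using sets_eq_imp_space_eq[OF p(2)] .
  have codep: "code \<in> borel_measurable (p n)" for n using codeA p(2) by (simp cong: measurable_cong_sets)
  define \<mu> where "\<mu> n = distr (p n) borel code" for n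
  have \<mu>: "real_distribution (\<mu> n)" for n
    unfolding \<mu>_def by (rule prob_space.real_distribution_distr[OF p(1) codep])
  have "tight \<mu>"
    unfolding tight_def
  proof (intro conjI allI impI \<mu>)
    fix \<epsilon> :: real assume \<epsilon>: "0 < \<epsilon>"
    have "measure (\<mu> n) {-1<..1} = 1" for n
    proof -
      have "-1 < code z" "code z \<le> 1" for z
        using ternary_nonneg[of "\<lambda>n. b n z"] ternary_le_1[of "\<lambda>n. b n z"] unfolding code_def by linarith+
      then have "code -` {-1<..1} \<inter> space (p n) = space (p n)" by auto
      then show ?thesis
        unfolding \<mu>_def using prob_space.prob_space[OF p(1)] by (subst measure_distr[OF codep]) auto
    qed
    then show "\<exists>a b. a < b \<and> (\<forall>n. 1 - \<epsilon> < measure (\<mu> n) {a<..b})"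
      using \<epsilon> by (intro exI[of _ "-1"] exI[of _ 1]) simp
  qed
  from tight_imp_convergent_subsubsequence[OF this strict_mono_id] obtain r L
    where r: "strict_mono r" and L: "real_distribution L" "weak_conv_m (\<lambda>j. \<mu> (r j)) L"
    by (auto simp: comp_def)
  from Skorohod[OF \<mu> L] obtain \<Omega> :: "real measure" and Z :: "nat \<Rightarrow> real \<Rightarrow> real" and Y :: "real \<Rightarrow> real"
    where "prob_space \<Omega> \<and> (\<forall>j. Z j \<in> borel_measurable \<Omega>) \<and> (\<forall>j. distr \<Omega> borel (Z j) = \<mu> (r j)) \<and>
      Y \<in> measurable \<Omega> lborel \<and> distr \<Omega> borel Y = L \<and> (\<forall>w\<in>space \<Omega>. (\<lambda>j. Z j w) \<longlonglongrightarrow> Y w)"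
    by (elim exE) (rule that)
  then have \<Omega>: "prob_space \<Omega>" and Z: "\<And>j. Z j \<in> borel_measurable \<Omega>" "\<And>j. distr \<Omega> borel (Z j) = \<mu> (r j)"
    and Y: "Y \<in> borel_measurable \<Omega>" and lim: "\<And>w. w \<in> space \<Omega> \<Longrightarrow> (\<lambda>j. Z j w) \<longlonglongrightarrow> Y w"
    by simp_all
  \<comment> \<open>Decoding searches for the set bit. Stopping at \<open>m k\<close> leaves true
    codes unchanged, as they are at most \<open>m k\<close>, and makes \<open>l k\<close> depend on
    finitely many digits only; hence it is eventually constant along a convergent sequence of points
    of the Cantor set.\<close>
  define l where "l k y = (LEAST i. m k \<le> i \<or> ternary_digit (prod_encode (k, i)) y)" for k and y :: real
  have lm: "l k \<in> measurable borel (count_space UNIV)" for k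
    unfolding l_def by (intro measurable_Least) measurable
  have lcode: "l k (code z) = c k z" if "z \<in> space A" for k z
  proof -
    have "l k (code z) = (LEAST i. m k \<le> i \<or> c k z = i)"
      by (simp add: l_def code_def ternary_digit_ternary b_def)
    also have "\<dots> = c k z" using m[OF that] by (intro Least_equality) (auto intro: order_trans)
    finally show ?thesis .
  qed
  \<comment> \<open>Being reproduced by one's digits is a Borel condition that holds for all codes.
    Unlike membership in the image of \<open>code\<close>, it passes to the variables
    \<open>Z j\<close> through their law.\<close>
  have Yp: "AE y in \<mu> n. ternary (\<lambda>i. ternary_digit i y) = y" for n
  proof -
    have tm: "(\<lambda>y. ternary (\<lambda>i. ternary_digit i y)) \<in> borel_measurable borel"
      by (intro ternary_measurable ternary_digit_measurable)
    have "{y \<in> space borel. ternary (\<lambda>i. ternary_digit i y) = y} \<in> sets borel"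
      using tm by measurable
    then show ?thesis
      unfolding \<mu>_def by (subst AE_distr_iff[OF codep]) (auto simp: code_def ternary_digit_ternary)
  qed
  have "AE w in \<Omega>. \<forall>j. ternary (\<lambda>i. ternary_digit i (Z j w)) = Z j w"
    unfolding AE_all_countable
  proof
    fix j
    show "AE w in \<Omega>. ternary (\<lambda>i. ternary_digit i (Z j w)) = Z j w"
      using Yp[of "r j"] unfolding Z(2)[symmetric] by (rule AE_distrD[OF Z(1)])
  qed
  then have ev: "AE w in \<Omega>. \<forall>k. eventually (\<lambda>j. l k (Z j w) = l k (Y w)) sequentially"
    using AE_space
  proof eventually_elim
    case (elim w)
    show ?case
    proof
      fix k
      have "(\<lambda>j. ternary (\<lambda>i. ternary_digit i (Z j w))) \<longlonglongrightarrow> Y w" using lim[OF elim(2)] elim(1) by simp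
      note d = eventually_ternary_digit[OF this]
      have "eventually (\<lambda>j. \<forall>i\<in>{..<m k}. ternary_digit (prod_encode (k, i)) (Z j w) = ternary_digit (prod_encode (k, i)) (Y w)) sequentially"
        using d by (intro eventually_ball_finite) auto
      then show "eventually (\<lambda>j. l k (Z j w) = l k (Y w)) sequentially"
      proof eventually_elim
        case (elim j)
        then have "(\<lambda>i. m k \<le> i \<or> ternary_digit (prod_encode (k, i)) (Z j w)) = (\<lambda>i. m k \<le> i \<or> ternary_digit (prod_encode (k, i)) (Y w))"
          by (auto simp: fun_eq_iff not_le)
        then show ?case by (simp add: l_def)
      qed
    qed
  qed
  \<comment> \<open>Pairs are compared because distances between approximations of two different
    accuracies will be integrated.\<close>
  have law: "distr \<Omega> (count_space UNIV) (\<lambda>w. (l k (Z j w), l k' (Z j w))) =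
      distr (p (r j)) (count_space UNIV) (\<lambda>z. (c k z, c k' z))" for j k k'
  proof -
    have m2: "(\<lambda>y. (l k y, l k' y)) \<in> measurable borel (count_space UNIV)"
      using lm[of k, measurable] lm[of k', measurable] by measurable
    have "distr \<Omega> (count_space UNIV) (\<lambda>w. (l k (Z j w), l k' (Z j w))) = distr (\<mu> (r j)) (count_space UNIV) (\<lambda>y. (l k y, l k' y))"
      using distr_distr[OF m2 Z(1)[of j]] by (simp add: Z(2) comp_def)
    also have "\<dots> = distr (p (r j)) (count_space UNIV) (\<lambda>z. (l k (code z), l k' (code z)))"
      using distr_distr[OF m2 codep[of "r j"]] by (simp add: \<mu>_def comp_def)
    also have "\<dots> = distr (p (r j)) (count_space UNIV) (\<lambda>z. (c k z, c k' z))"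
      by (intro distr_cong) (auto simp: lcode sp)
    finally show ?thesis .
  qed
  show ?thesis
    by (rule that[of r \<Omega> "\<lambda>j k w. l k (Z j w)" "\<lambda>k w. l k (Y w)"])
      (use r \<Omega> measurable_compose[OF Z(1) lm] measurable_compose[OF Y lm] law ev in auto)
qed

section \<open>Sequential compactness\<close>

text \<open>The last element is repeated forever: every natural number is then a valid code, while
  the codes up to \<open>m\<close> already reach all of \<open>S\<close>.\<close>

lemma finite_eq_range:
  assumes "finite S" "S \<noteq> {}"
  obtains f :: "nat \<Rightarrow> 'a" and m where "range f = S" "f ` {..m} = S"
proof -
  obtain g n where g: "S = g ` {i::nat. i < n}" using finite_imp_nat_seg_image_inj_on[OF assms(1)] by blast
  then have n: "0 < n" using assms(2) by auto
  define f where "f i = g (min i (n - 1))" for i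
  have "range f \<subseteq> S" using n by (auto simp: g f_def)
  moreover have "S \<subseteq> f ` {..n - 1}"
  proof
    fix s assume "s \<in> S"
    then obtain i where i: "i < n" "s = g i" by (auto simp: g)
    then have "s = f i" by (simp add: f_def min.absorb1)
    then show "s \<in> f ` {..n - 1}" using i by auto
  qed
  ultimately have "range f = S" "f ` {..n - 1} = S" by auto
  then show ?thesis by (rule that)
qed

context Metric_space
begin

lemma MCauchy_if_summable:
  assumes M: "range s \<subseteq> M" and sum: "summable (\<lambda>k. d (s k) (s (Suc k)))"
  shows "MCauchy s"
proof -
  have sM: "s n \<in> M" for n using M by auto
  have chain: "d (s n) (s (n + i)) \<le> (\<Sum>k\<in>{n..<n + i}. d (s k) (s (Suc k)))" for n i
  proof (induction i)
    case 0
    show ?case using sM by simp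
  next
    case (Suc i)
    have "d (s n) (s (n + Suc i)) \<le> d (s n) (s (n + i)) + d (s (n + i)) (s (Suc (n + i)))"
      using triangle[OF sM sM sM] by simp
    also have "\<dots> \<le> (\<Sum>k\<in>{n..<n + i}. d (s k) (s (Suc k))) + d (s (n + i)) (s (Suc (n + i)))"
      using Suc by simp
    finally show ?case by simp
  qed
  have "\<exists>N. \<forall>n n'. N \<le> n \<longrightarrow> N \<le> n' \<longrightarrow> d (s n) (s n') < \<epsilon>" if \<epsilon>: "0 < \<epsilon>" for \<epsilon>
  proof -
    obtain N where N: "\<And>m n. N \<le> m \<Longrightarrow> norm (\<Sum>k\<in>{m..<n}. d (s k) (s (Suc k))) < \<epsilon>"
      using sum \<epsilon> unfolding summable_Cauchy by blast
    have *: "d (s n) (s n') < \<epsilon>" if "N \<le> n" "n \<le> n'" for n n'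
      using chain[of n "n' - n"] N[OF that(1), of n'] that(2) by simp
    have "d (s n) (s n') < \<epsilon>" if "N \<le> n" "N \<le> n'" for n n'
    proof (cases "n \<le> n'")
      case True
      then show ?thesis using * that by blast
    next
      case False
      then have "d (s n') (s n) < \<epsilon>" using * that by simp
      then show ?thesis by (simp add: commute)
    qed
    then show ?thesis by blast
  qed
  then show ?thesis using M by (simp add: MCauchy_def)
qed

text \<open>The consecutive distances have a sum of finite integral, so it is finite almost
  everywhere and the sequence is Cauchy there; Fatou's lemma carries the estimate to the limit.
  Measurability of the mutual distances is assumed since it can fail without separability.\<close>

lemma almost_sure_limit:
  fixes h :: "nat \<Rightarrow> 'b \<Rightarrow> 'a"
  assumes mcomplete and h[measurable]: "\<And>k. h k \<in> measurable N (borel_on M d)" and a: "a \<in> M"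
    and dm[measurable]: "\<And>k l. (\<lambda>w. d (h k w) (h l w)) \<in> borel_measurable N"
    and le: "\<And>k l. (\<integral>\<^sup>+w. d (h k w) (h l w) \<partial>N) \<le> ennreal ((1 / 2) ^ k + (1 / 2) ^ l)"
  obtains g where "g \<in> measurable N (borel_on M d)"
    "AE w in N. limitin mtopology (\<lambda>k. h k w) (g w) sequentially"
    "\<And>k. (\<integral>\<^sup>+w. d (h k w) (g w) \<partial>N) \<le> ennreal (2 * (1 / 2) ^ k)"
proof -
  have hM: "h k w \<in> M" if "w \<in> space N" for k w using measurable_space[OF h that] by simp
  define T where "T w = (\<Sum>k. ennreal (d (h k w) (h (Suc k) w)))" for w
  have Tm[measurable]: "T \<in> borel_measurable N" unfolding T_def by measurable
  have "(\<integral>\<^sup>+w. T w \<partial>N) = (\<Sum>k. \<integral>\<^sup>+w. d (h k w) (h (Suc k) w) \<partial>N)"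
    unfolding T_def by (rule nn_integral_suminf) measurable
  also have "\<dots> \<le> (\<Sum>k. ennreal ((1 / 2) ^ k + (1 / 2) ^ Suc k))"
    by (intro suminf_le le summableI)
  also have "\<dots> = ennreal (\<Sum>k. (1 / 2) ^ k + (1 / 2) ^ Suc k)"
    by (intro suminf_ennreal2 summable_add summable_geometric sums_summable[OF power_half_series]) auto
  finally have "(\<integral>\<^sup>+w. T w \<partial>N) \<noteq> \<infinity>" by (auto simp: top_unique)
  from nn_integral_noteq_infinite[OF Tm this] have AET: "AE w in N. T w \<noteq> \<infinity>" .
  \<comment> \<open>On the exceptional null set the sequence becomes constant, so that it converges
    everywhere and its limit is measurable.\<close>
  define f where "f k w = (if T w \<noteq> \<infinity> then h k w else a)" for k w
  have fm: "f k \<in> measurable N (borel_on M d)" for k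
    unfolding f_def using a by (intro measurable_If h measurable_const) auto
  have fM: "f k w \<in> M" if "w \<in> space N" for k w using hM[OF that] a by (simp add: f_def)
  have "MCauchy (\<lambda>k. f k w)" if w: "w \<in> space N" for w
  proof (cases "T w \<noteq> \<infinity>")
    case True
    have "summable (\<lambda>k. d (h k w) (h (Suc k) w))"
      using True by (intro summable_suminf_not_top) (auto simp: T_def)
    then show ?thesis using True hM[OF w] by (intro MCauchy_if_summable) (auto simp: f_def)
  qed (simp add: f_def a)
  then have "\<exists>l. limitin mtopology (\<lambda>k. f k w) l sequentially" if "w \<in> space N" for w
    using that assms(1) unfolding mcomplete_def by blast
  then obtain g where g: "\<And>w. w \<in> space N \<Longrightarrow> limitin mtopology (\<lambda>k. f k w) (g w) sequentially" by metis
  have gm: "g \<in> measurable N (borel_on M d)" by (rule borel_on_measurable_limit[OF fm g])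
  have lim: "AE w in N. limitin mtopology (\<lambda>k. h k w) (g w) sequentially"
    using AET AE_space
  proof eventually_elim
    case (elim w)
    then show ?case using g[OF elim(2)] by (simp add: f_def)
  qed
  have "(\<integral>\<^sup>+w. d (h k w) (g w) \<partial>N) \<le> ennreal (2 * (1 / 2) ^ k)" for k
  proof -
    have "(\<integral>\<^sup>+w. d (h k w) (g w) \<partial>N) = (\<integral>\<^sup>+w. liminf (\<lambda>l. ennreal (d (h k w) (h l w))) \<partial>N)"
    proof (rule nn_integral_cong_AE, use lim AE_space in eventually_elim)
      fix w assume l: "limitin mtopology (\<lambda>k. h k w) (g w) sequentially" and w: "w \<in> space N"
      have gM: "g w \<in> M" using limitin_mspace[OF l] .
      have null: "(\<lambda>i. d (h i w) (g w)) \<longlonglongrightarrow> 0" using l by (simp add: limitin_metric_dist_null)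
      have "norm (d (h k w) (h i w) - d (h k w) (g w)) \<le> d (h i w) (g w)" for i
        using mdist_reverse_triangle[of "h i w" "h k w" "g w"] hM[OF w] gM by (simp add: commute)
      then have "(\<lambda>i. d (h k w) (h i w) - d (h k w) (g w)) \<longlonglongrightarrow> 0"
        by (rule Lim_null_comparison[OF always_eventually[OF allI] null])
      then have "(\<lambda>l. d (h k w) (h l w)) \<longlonglongrightarrow> d (h k w) (g w)" by (rule LIM_zero_cancel)
      then have "(\<lambda>l. ennreal (d (h k w) (h l w))) \<longlonglongrightarrow> ennreal (d (h k w) (g w))" by (rule tendsto_ennrealI)
      then show "ennreal (d (h k w) (g w)) = liminf (\<lambda>l. ennreal (d (h k w) (h l w)))"
        by (intro lim_imp_Liminf[symmetric]) simp
    qed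
    also have "\<dots> \<le> liminf (\<lambda>l. \<integral>\<^sup>+w. d (h k w) (h l w) \<partial>N)"
      by (rule nn_integral_liminf) measurable
    also have "\<dots> \<le> liminf (\<lambda>l::nat. ennreal (2 * (1 / 2) ^ k))"
    \<comment> \<open>Only the terms with l at least k matter, and for them both powers are at most
      (1/2) ^ k.\<close>
    proof (rule Liminf_mono, rule eventually_sequentiallyI)
      fix l assume "k \<le> l"
      then have "(1 / 2) ^ l \<le> (1 / 2 :: real) ^ k" by (intro power_decreasing) auto
      then have "ennreal ((1 / 2) ^ k + (1 / 2) ^ l) \<le> ennreal (2 * (1 / 2) ^ k)" by (intro ennreal_leI) simp
      then show "(\<integral>\<^sup>+w. d (h k w) (h l w) \<partial>N) \<le> ennreal (2 * (1 / 2) ^ k)" using le order_trans by blast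
    qed
    finally show ?thesis by (simp add: Liminf_const)
  qed
  with gm lim show ?thesis by (rule that)
qed

lemma dist_bounded_finite:
  assumes "finite S" "finite T"
  shows "\<exists>B. \<forall>s\<in>S. \<forall>t\<in>T. d s t \<le> B"
proof -
  have "bdd_above ((\<lambda>(s, t). d s t) ` (S \<times> T))" using assms by (intro bdd_above_finite) simp
  then show ?thesis unfolding bdd_above_def by fast
qed

theorem kantorovich_convergent_subsequence:
  fixes p :: "nat \<Rightarrow> 'a measure"
  assumes complete: mcomplete and p: "\<And>n. p n \<in> kantorovich_space M d"
    and approx: "\<And>\<epsilon>. 0 < \<epsilon> \<Longrightarrow> \<exists>S. finite S \<and> S \<noteq> {} \<and> S \<subseteq> M \<and> (\<forall>n. (\<integral>y. (INF s\<in>S. d s y) \<partial>(p n)) \<le> \<epsilon>)"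
  shows "\<exists>q r. q \<in> kantorovich_space M d \<and> strict_mono (r :: nat \<Rightarrow> nat) \<and>
    limitin (Metric_space.mtopology (kantorovich_space M d) (kantorovich_dist M d)) (p \<circ> r) q sequentially"
proof -
  interpret P: Metric_space "kantorovich_space M d" "kantorovich_dist M d" by (rule Metric_space_kantorovich)
  let ?B = "borel_on M d"
  have "\<exists>S. finite S \<and> S \<noteq> {} \<and> S \<subseteq> M \<and> (\<forall>n. (\<integral>y. (INF s\<in>S. d s y) \<partial>(p n)) \<le> (1 / 2) ^ k)" for k :: nat
    by (rule approx) simp
  then obtain S where S: "\<And>k. finite (S k)" "\<And>k. S k \<noteq> {}" "\<And>k. S k \<subseteq> M"
    and int: "\<And>k n. (\<integral>y. (INF s\<in>S k. d s y) \<partial>(p n)) \<le> (1 / 2) ^ k" by metis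
  have "\<exists>f m. range f = S k \<and> f ` {..m::nat} = S k" for k
    by (rule finite_eq_range[OF S(1,2)[of k]]) (intro exI conjI)
  then obtain x m where x: "\<And>k. range (x k) = S k" "\<And>k. x k ` {..m k::nat} = S k" by metis
  have xS: "x k i \<in> S k" for k i using x(1)[of k] by auto
  have xM: "x k i \<in> M" for k i using xS S(3) by blast
  have xm: "x k \<in> measurable (count_space UNIV) ?B" for k using xM by simp
  \<comment> \<open>The code of z is the first index of a point of \<open>S k\<close> nearest to z,
    so replacing z by \<open>x k (c k z)\<close> costs exactly its distance to
    \<open>S k\<close>.\<close>
  define c where "c k z = (LEAST i. d (x k i) z = (INF s\<in>S k. d s z))" for k z
  have "\<exists>i\<le>m k. d (x k i) z = (INF s\<in>S k. d s z)" for k z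
  proof -
    have "(INF s\<in>S k. d s z) = Min ((\<lambda>s. d s z) ` S k)" using S by (intro cInf_eq_Min) auto
    also have "\<dots> \<in> (\<lambda>s. d s z) ` S k" using S by (intro Min_in) auto
    finally obtain s where s: "s \<in> S k" "(INF s\<in>S k. d s z) = d s z" by auto
    then obtain i where "i \<le> m k" "s = x k i" using x(2)[of k] by blast
    then show ?thesis using s by auto
  qed
  then have c: "d (x k (c k z)) z = (INF s\<in>S k. d s z)" "c k z \<le> m k" for k z
    unfolding c_def by (metis (mono_tags, lifting) LeastI, metis (mono_tags, lifting) Least_le order_trans)
  have cm: "c k \<in> measurable ?B (count_space UNIV)" for k
  proof -
    have [measurable]: "(\<lambda>z. d (x k i) z) \<in> borel_measurable ?B" "(\<lambda>z. INF s\<in>S k. d s z) \<in> borel_measurable ?B" for i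
      using dist_measurable[OF xM] dist_set_measurable[OF S(3,2)] by auto
    show ?thesis unfolding c_def by (intro measurable_Least) measurable
  qed
  obtain r :: "nat \<Rightarrow> nat" and \<Omega> :: "real measure" and C :: "nat \<Rightarrow> nat \<Rightarrow> real \<Rightarrow> nat" and C' :: "nat \<Rightarrow> real \<Rightarrow> nat"
    where r: "strict_mono r" and \<Omega>: "prob_space \<Omega>"
      and C: "\<And>j k. C j k \<in> measurable \<Omega> (count_space UNIV)" and C': "\<And>k. C' k \<in> measurable \<Omega> (count_space UNIV)"
      and law: "\<And>j k l. distr \<Omega> (count_space UNIV) (\<lambda>w. (C j k w, C j l w)) =
        distr (p (r j)) (count_space UNIV) (\<lambda>z. (c k z, c l z))"
      and ev: "AE w in \<Omega>. \<forall>k. eventually (\<lambda>j. C j k w = C' k w) sequentially"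
    using finite_codes_subsequence[where p=p and c=c and m=m, OF kantorovich_spaceD(1)[OF p] kantorovich_spaceD(2)[OF p] cm c(2)]
    by blast
  interpret \<Omega>: prob_space \<Omega> by fact
  note prob_p = kantorovich_spaceD(1)[OF p] and sets_p = kantorovich_spaceD(2)[OF p] and space_p = kantorovich_spaceD(3)[OF p]
  have cp: "c k \<in> measurable (p n) (count_space UNIV)" for k n
    using cm[of k] measurable_cong_sets[OF sets_p[of n] refl, of "count_space (UNIV :: nat set)"] by blast
  \<comment> \<open>The probability space is left arbitrary because the facts serve variables on
    \<Omega> as well as on the measures \<open>p n\<close>.\<close>
  have fin_law: "distr N ?B (\<lambda>w. x k (f w)) \<in> kantorovich_space M d" and fin_meas: "(\<lambda>w. x k (f w)) \<in> measurable N ?B"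
    if N: "prob_space N" and f: "f \<in> measurable N (count_space UNIV)" for N :: "'c measure" and f k
  proof -
    show m: "(\<lambda>w. x k (f w)) \<in> measurable N ?B" by (rule measurable_compose[OF f xm])
    obtain b where b: "\<forall>t\<in>S k. d (x 0 0) t \<le> b"
      using dist_bounded_finite[of "{x 0 0}" "S k"] S(1) by auto
    show "distr N ?B (\<lambda>w. x k (f w)) \<in> kantorovich_space M d"
    proof (rule distr_in_kantorovich_space_if_separable[OF complete N m])
      show "range (x k) \<subseteq> M" using xM by auto
      show "AE w in N. x k (f w) \<in> mtopology closure_of range (x k)"
        using closure_of_subset[of "range (x k)" mtopology] xM by (intro AE_I2) auto
      show "x 0 0 \<in> M" by (rule xM)
      show "integrable N (\<lambda>w. d (x 0 0) (x k (f w)))"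
      proof (rule finite_measure.integrable_const_bound[where B=b])
        show "finite_measure N" using N by (rule prob_space.finite_measure)
        show "AE w in N. norm (d (x 0 0) (x k (f w))) \<le> b" using b xS by (intro AE_I2) auto
        show "(\<lambda>w. d (x 0 0) (x k (f w))) \<in> borel_measurable N"
          by (rule measurable_compose[OF f]) simp
      qed
    qed
  qed
  have dm: "(\<lambda>w. d (x k (f w)) (x l (g w))) \<in> borel_measurable \<Omega>"
    if f: "f \<in> measurable \<Omega> (count_space UNIV)" and g: "g \<in> measurable \<Omega> (count_space UNIV)" for f g k l
  proof -
    have "(\<lambda>w. (f w, g w)) \<in> measurable \<Omega> (count_space UNIV)"
      using f[measurable] g[measurable] by measurable
    then have "(\<lambda>w. (\<lambda>u. d (x k (fst u)) (x l (snd u))) (f w, g w)) \<in> borel_measurable \<Omega>"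
      by (rule measurable_compose) simp
    then show ?thesis by simp
  qed
  obtain b where b: "\<And>k l s t. s \<in> S k \<Longrightarrow> t \<in> S l \<Longrightarrow> d s t \<le> b k l"
    using dist_bounded_finite[OF S(1) S(1)] by metis
  have di: "integrable \<Omega> (\<lambda>w. d (x k (f w)) (x l (g w)))"
    if f: "f \<in> measurable \<Omega> (count_space UNIV)" and g: "g \<in> measurable \<Omega> (count_space UNIV)" for f g k l
    using b xS by (intro \<Omega>.integrable_const_bound[where B="b k l"] AE_I2 dm that) auto
  \<comment> \<open>The integrand depends on the two codes alone, so the joint law moves it to
    \<open>p (r j)\<close>. There both approximations come from the same point z, and the triangle
    inequality through z applies.\<close>
  have int1: "(\<integral>w. d (x k (C j k w)) (x l (C j l w)) \<partial>\<Omega>) \<le> (1 / 2) ^ k + (1 / 2) ^ l" for j k l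
  proof -
    let ?n = "r j"
    have Cm: "(\<lambda>w. (C j k w, C j l w)) \<in> measurable \<Omega> (count_space UNIV)"
      using C[measurable] by measurable
    have cm2: "(\<lambda>w. (c k w, c l w)) \<in> measurable (p ?n) (count_space UNIV)"
      using cp[measurable] by measurable
    let ?\<phi> = "\<lambda>u. d (x k (fst u)) (x l (snd u))"
    have "(\<integral>w. d (x k (C j k w)) (x l (C j l w)) \<partial>\<Omega>) = (\<integral>u. ?\<phi> u \<partial>(distr \<Omega> (count_space UNIV) (\<lambda>w. (C j k w, C j l w))))"
      by (subst integral_distr[OF Cm]) auto
    also have "\<dots> = (\<integral>z. d (x k (c k z)) (x l (c l z)) \<partial>(p ?n))"
      unfolding law by (subst integral_distr[OF cm2]) auto
    also have "\<dots> \<le> (\<integral>z. (INF s\<in>S k. d s z) + (INF s\<in>S l. d s z) \<partial>(p ?n))"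
    proof (rule integral_mono_AE)
      interpret pn: prob_space "p ?n" by (rule prob_p)
      show "integrable (p ?n) (\<lambda>z. d (x k (c k z)) (x l (c l z)))"
      proof (rule pn.integrable_const_bound[where B="b k l"])
        show "AE z in p ?n. norm (d (x k (c k z)) (x l (c l z))) \<le> b k l" using b xS by (intro AE_I2) auto
        show "(\<lambda>z. d (x k (c k z)) (x l (c l z))) \<in> borel_measurable (p ?n)"
          using measurable_compose[OF cm2, of ?\<phi>] by simp
      qed
      show "integrable (p ?n) (\<lambda>z. (INF s\<in>S k. d s z) + (INF s\<in>S l. d s z))"
        by (intro Bochner_Integration.integrable_add integrable_dist_set p S)
      show "AE z in p ?n. d (x k (c k z)) (x l (c l z)) \<le> (INF s\<in>S k. d s z) + (INF s\<in>S l. d s z)"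
      proof (rule AE_I2)
        fix z assume "z \<in> space (p ?n)"
        then have "z \<in> M" by (simp add: space_p)
        then show "d (x k (c k z)) (x l (c l z)) \<le> (INF s\<in>S k. d s z) + (INF s\<in>S l. d s z)"
          using triangle'[OF xM _ xM, of z k "c k z" l "c l z"] by (simp add: c(1))
      qed
    qed
    also have "\<dots> = (\<integral>z. (INF s\<in>S k. d s z) \<partial>(p ?n)) + (\<integral>z. (INF s\<in>S l. d s z) \<partial>(p ?n))"
      by (intro Bochner_Integration.integral_add integrable_dist_set p S)
    finally show ?thesis using int[of ?n k] int[of ?n l] by linarith
  qed
  define h where "h k w = x k (C' k w)" for k w
  have hm: "h k \<in> measurable \<Omega> ?B" for k unfolding h_def by (rule fin_meas[OF \<Omega> C'])
  \<comment> \<open>Almost surely the codes are eventually equal to their limits, so the integrands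
    are eventually constant; they are bounded since \<open>S k\<close> and \<open>S l\<close> are
    finite.\<close>
  have int2: "(\<integral>w. d (h k w) (h l w) \<partial>\<Omega>) \<le> (1 / 2) ^ k + (1 / 2) ^ l" for k l
  proof (rule LIMSEQ_le_const2)
    show "(\<lambda>j. \<integral>w. d (x k (C j k w)) (x l (C j l w)) \<partial>\<Omega>) \<longlonglongrightarrow> (\<integral>w. d (h k w) (h l w) \<partial>\<Omega>)"
    proof (rule integral_dominated_convergence[where w="\<lambda>_. b k l"])
      show "AE w in \<Omega>. (\<lambda>j. d (x k (C j k w)) (x l (C j l w))) \<longlonglongrightarrow> d (h k w) (h l w)"
        using ev
      proof eventually_elim
        case (elim w)
        then have "eventually (\<lambda>j. C j k w = C' k w \<and> C j l w = C' l w) sequentially"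
          by (auto intro: eventually_conj)
        then have "eventually (\<lambda>j. d (x k (C j k w)) (x l (C j l w)) = d (h k w) (h l w)) sequentially"
          by eventually_elim (simp add: h_def)
        then show ?case by (rule tendsto_eventually)
      qed
      show "AE w in \<Omega>. norm (d (x k (C j k w)) (x l (C j l w))) \<le> b k l" for j
        using b xS by (intro AE_I2) auto
    qed (use dm C C' in \<open>auto simp: h_def\<close>)
  qed (use int1 in auto)
  have lim2: "(\<lambda>j. \<integral>w. d (x k (C j k w)) (h k w) \<partial>\<Omega>) \<longlonglongrightarrow> 0" for k
  proof -
    have "(\<lambda>j. \<integral>w. d (x k (C j k w)) (h k w) \<partial>\<Omega>) \<longlonglongrightarrow> (\<integral>w. 0 \<partial>\<Omega>)"
    proof (rule integral_dominated_convergence[where w="\<lambda>_. b k k"])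
      show "AE w in \<Omega>. (\<lambda>j. d (x k (C j k w)) (h k w)) \<longlonglongrightarrow> 0"
        using ev
      proof eventually_elim
        case (elim w)
        then have "eventually (\<lambda>j. C j k w = C' k w) sequentially" by blast
        then have "eventually (\<lambda>j. d (x k (C j k w)) (h k w) = 0) sequentially"
          by eventually_elim (simp add: h_def xM)
        then show ?case by (rule tendsto_eventually)
      qed
      show "AE w in \<Omega>. norm (d (x k (C j k w)) (h k w)) \<le> b k k" for j
        using b xS by (intro AE_I2) (auto simp: h_def)
    qed (use dm C C' in \<open>auto simp: h_def\<close>)
    then show ?thesis by simp
  qed
  have hdm: "(\<lambda>w. d (h k w) (h l w)) \<in> borel_measurable \<Omega>" for k l
    unfolding h_def by (rule dm[OF C' C'])
  have nn: "(\<integral>\<^sup>+w. d (h k w) (h l w) \<partial>\<Omega>) \<le> ennreal ((1 / 2) ^ k + (1 / 2) ^ l)" for k l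
  proof -
    have "integrable \<Omega> (\<lambda>w. d (h k w) (h l w))" unfolding h_def by (rule di[OF C' C'])
    then have "(\<integral>\<^sup>+w. d (h k w) (h l w) \<partial>\<Omega>) = ennreal (\<integral>w. d (h k w) (h l w) \<partial>\<Omega>)"
      by (intro nn_integral_eq_integral) auto
    then show ?thesis using ennreal_leI[OF int2] by (simp only:)
  qed
  obtain g where g: "g \<in> measurable \<Omega> ?B" and lim: "AE w in \<Omega>. limitin mtopology (\<lambda>k. h k w) (g w) sequentially"
    and gle: "\<And>k. (\<integral>\<^sup>+w. d (h k w) (g w) \<partial>\<Omega>) \<le> ennreal (2 * (1 / 2) ^ k)"
    using almost_sure_limit[where N=\<Omega> and h=h, OF complete hm xM[of 0 0] hdm nn] by blast
  \<comment> \<open>Here \<open>h k\<close> takes countably many values, so measurability follows by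
    splitting according to its code.\<close>
  have hgm: "(\<lambda>w. d (h k w) (g w)) \<in> borel_measurable \<Omega>" for k
    unfolding h_def by (rule measurable_compose_countable[OF _ C']) (rule measurable_compose[OF g dist_measurable[OF xM]])
  have hgi: "integrable \<Omega> (\<lambda>w. d (h k w) (g w))" for k
    using gle[of k] by (intro integrableI_bounded hgm) (auto simp: le_less_trans)
  have hgle: "(\<integral>w. d (h k w) (g w) \<partial>\<Omega>) \<le> 2 * (1 / 2) ^ k" for k
    using gle[of k] nn_integral_eq_integral[OF hgi[of k]] by simp
  define q where "q = distr \<Omega> ?B g"
  have qP: "q \<in> kantorovich_space M d"
    unfolding q_def
  proof (rule distr_in_kantorovich_space_if_separable[OF complete \<Omega> g])
    \<comment> \<open>All points of all the finite sets in one sequence; \<open>h k w\<close> is one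
      of them for every k, so their limit lies in its closure.\<close>
    let ?y = "\<lambda>n. x (fst (prod_decode n)) (snd (prod_decode n))"
    show "range ?y \<subseteq> M" using xM by auto
    have y: "x k i \<in> range ?y" for k i
    proof -
      have "x k i = ?y (prod_encode (k, i))" by simp
      then show ?thesis by blast
    qed
    show "AE w in \<Omega>. g w \<in> mtopology closure_of range ?y"
      using lim
    proof eventually_elim
      case (elim w)
      have "\<exists>z\<in>range ?y. z \<in> mball (g w) e" if e: "0 < e" for e
      proof -
        from elim e have "eventually (\<lambda>k. h k w \<in> M \<and> d (h k w) (g w) < e) sequentially"
          by (simp add: limitin_metric)
        then obtain k where k: "h k w \<in> M" "d (h k w) (g w) < e" by (auto simp: eventually_sequentially)
        then have "h k w \<in> mball (g w) e" using limitin_mspace[OF elim] by (simp add: commute)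
        moreover have "h k w \<in> range ?y" unfolding h_def by (rule y)
        ultimately show ?thesis by blast
      qed
      then show ?case using limitin_mspace[OF elim] by (simp add: metric_closure_of)
    qed
    show "x 0 0 \<in> M" by (rule xM)
    have "integrable \<Omega> (\<lambda>w. d (x 0 0) (x 0 (C' 0 w)) + d (h 0 w) (g w))"
      by (intro Bochner_Integration.integrable_add hgi di C') simp
    then show "integrable \<Omega> (\<lambda>w. d (x 0 0) (g w))"
    proof (rule Bochner_Integration.integrable_bound)
      show "(\<lambda>w. d (x 0 0) (g w)) \<in> borel_measurable \<Omega>" by (rule measurable_compose[OF g dist_measurable[OF xM]])
      show "AE w in \<Omega>. norm (d (x 0 0) (g w)) \<le> norm (d (x 0 0) (x 0 (C' 0 w)) + d (h 0 w) (g w))"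
      proof (rule AE_I2)
        fix w assume "w \<in> space \<Omega>"
        then have "g w \<in> M" using measurable_space[OF g] by simp
        then show "norm (d (x 0 0) (g w)) \<le> norm (d (x 0 0) (x 0 (C' 0 w)) + d (h 0 w) (g w))"
          using triangle[OF xM xM, of "g w" 0 0 0 "C' 0 w"] by (simp add: h_def)
      qed
    qed
  qed
  \<comment> \<open>Three moves: from \<open>p (r j)\<close> to the law of its nearest points costs
    (1/2) ^ k, from there to the law of \<open>h k\<close> costs the integral, and from
    \<open>h k\<close> to the limit costs 2 * (1/2) ^ k.\<close>
  have T: "kantorovich_dist M d (p (r j)) q \<le> 3 * (1 / 2) ^ k + (\<integral>w. d (x k (C j k w)) (h k w) \<partial>\<Omega>)" for j k
  proof -
    let ?n = "r j"
    let ?T = "distr \<Omega> ?B (\<lambda>w. x k (C j k w))" and ?T' = "distr \<Omega> ?B (h k)"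
    have TP: "?T \<in> kantorovich_space M d" "?T' \<in> kantorovich_space M d"
      using fin_law[OF \<Omega> C] fin_law[OF \<Omega> C'] by (simp_all add: h_def[abs_def])
    \<comment> \<open>The law of a single code is read off from the pair law with both accuracies
      equal.\<close>
    have TT: "?T = distr (p ?n) ?B (\<lambda>z. x k (c k z))"
    proof -
      have Cm: "(\<lambda>w. (C j k w, C j k w)) \<in> measurable \<Omega> (count_space UNIV)"
        using C[measurable] by measurable
      have cm2: "(\<lambda>w. (c k w, c k w)) \<in> measurable (p ?n) (count_space UNIV)"
        using cp[measurable] by measurable
      have xf: "(\<lambda>u. x k (fst u)) \<in> measurable (count_space UNIV :: (nat \<times> nat) measure) ?B" using xM by simp
      show ?thesis
        using arg_cong[OF law[of j k k], of "\<lambda>N. distr N ?B (\<lambda>u. x k (fst u))"]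
        by (simp add: distr_distr[OF xf Cm] distr_distr[OF xf cm2] comp_def)
    qed
    have id: "(\<lambda>z. z) \<in> measurable (p ?n) ?B" "distr (p ?n) ?B (\<lambda>z. z) = p ?n"
      using sets_p by (simp_all add: distr_id2 cong: measurable_cong_sets)
    have "kantorovich_dist M d (distr (p ?n) ?B (\<lambda>z. z)) (distr (p ?n) ?B (\<lambda>z. x k (c k z))) \<le> (\<integral>z. (INF s\<in>S k. d s z) \<partial>(p ?n))"
      using p TP(1) by (intro kantorovich_dist_le_random_variables prob_p id fin_meas cp integrable_dist_set S p AE_I2)
        (simp_all add: id c(1) commute[of _ "x k _"] flip: TT)
    then have 1: "kantorovich_dist M d (p ?n) ?T \<le> (1 / 2) ^ k"
      using int[of ?n k] by (simp add: TT id)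
    have 2: "kantorovich_dist M d ?T ?T' \<le> (\<integral>w. d (x k (C j k w)) (h k w) \<partial>\<Omega>)"
      using TP by (intro kantorovich_dist_le_random_variables \<Omega> fin_meas C hm) (auto simp: h_def intro: di C C')
    have 3: "kantorovich_dist M d ?T' q \<le> (\<integral>w. d (h k w) (g w) \<partial>\<Omega>)"
      using TP qP unfolding q_def by (intro kantorovich_dist_le_random_variables \<Omega> hm g hgi) auto
    have "kantorovich_dist M d (p ?n) q \<le> kantorovich_dist M d (p ?n) ?T + kantorovich_dist M d ?T q"
      by (rule P.triangle[OF p TP(1) qP])
    also have "kantorovich_dist M d ?T q \<le> kantorovich_dist M d ?T ?T' + kantorovich_dist M d ?T' q"
      by (rule P.triangle[OF TP qP])
    finally show ?thesis using 1 2 3 hgle[of k] by linarith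
  qed
  have "limitin P.mtopology (p \<circ> r) q sequentially"
    unfolding P.limitin_metric
  proof (intro conjI allI impI qP)
    fix \<epsilon> :: real assume \<epsilon>: "0 < \<epsilon>"
    \<comment> \<open>This makes 3 * (1/2) ^ k less than \<epsilon> / 2. The accuracy k is fixed
      first; only then does j grow, to bring the integral below the other half.\<close>
    obtain k where k: "(1 / 2 :: real) ^ k < \<epsilon> / 6" using real_arch_pow_inv[of "\<epsilon> / 6" "1 / 2"] \<epsilon> by auto
    have "0 < \<epsilon> / 2" using \<epsilon> by simp
    from order_tendstoD(2)[OF lim2[of k] this]
    show "eventually (\<lambda>j. (p \<circ> r) j \<in> kantorovich_space M d \<and> kantorovich_dist M d ((p \<circ> r) j) q < \<epsilon>) sequentially"
    proof eventually_elim
      case (elim j)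
      then show ?case using T[of j k] k p by simp
    qed
  qed
  with qP r show ?thesis by blast
qed

end

section \<open>Properness of the marginal map\<close>

theorem theorem3p4p1:
  fixes X :: "'a set" and dX :: "'a \<Rightarrow> 'a \<Rightarrow> real"
    and Y :: "'b set" and dY :: "'b \<Rightarrow> 'b \<Rightarrow> real"
  assumes "Metric_space X dX" and "Metric_space.mcomplete X dX"
    and "Metric_space Y dY" and "Metric_space.mcomplete Y dY"
  shows "\<forall>K. compactin
        (Metric_space.mtopology (kantorovich_space X dX \<times> kantorovich_space Y dY)
          (sum_dist (kantorovich_dist X dX) (kantorovich_dist Y dY))) K \<longrightarrow>
      compactin
        (Metric_space.mtopology (kantorovich_space (X \<times> Y) (sum_dist dX dY))
          (kantorovich_dist (X \<times> Y) (sum_dist dX dY)))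
        {r \<in> kantorovich_space (X \<times> Y) (sum_dist dX dY). marginals X dX Y dY r \<in> K}"
proof (intro allI impI)
  interpret X: Metric_space X dX by fact
  interpret Y: Metric_space Y dY by fact
  interpret Z: Metric_space "X \<times> Y" "sum_dist dX dY" by (intro Metric_space_sum_dist assms)
  interpret PX: Metric_space "kantorovich_space X dX" "kantorovich_dist X dX" by (rule X.Metric_space_kantorovich)
  interpret PY: Metric_space "kantorovich_space Y dY" "kantorovich_dist Y dY" by (rule Y.Metric_space_kantorovich)
  interpret PZ: Metric_space "kantorovich_space (X \<times> Y) (sum_dist dX dY)" "kantorovich_dist (X \<times> Y) (sum_dist dX dY)"
    by (rule Z.Metric_space_kantorovich)
  interpret PP: Metric_space "kantorovich_space X dX \<times> kantorovich_space Y dY"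
    "sum_dist (kantorovich_dist X dX) (kantorovich_dist Y dY)"
    by (intro Metric_space_sum_dist PX.Metric_space_axioms PY.Metric_space_axioms)
  fix K assume K: "compactin PP.mtopology K"
  let ?F = "{r \<in> kantorovich_space (X \<times> Y) (sum_dist dX dY). marginals X dX Y dY r \<in> K}"
  have closed: "closedin PZ.mtopology ?F"
    using closedin_continuous_map_preimage[OF continuous_map_marginals[OF assms(1,3)]
        compactin_imp_closedin[OF PP.Hausdorff_space_mtopology K]] by simp
  have KX: "compactin PX.mtopology (fst ` K)"
    by (intro image_compactin[OF K] continuous_map_fst_snd_sum_dist PX.Metric_space_axioms PY.Metric_space_axioms)
  have KY: "compactin PY.mtopology (snd ` K)"
    by (intro image_compactin[OF K] continuous_map_fst_snd_sum_dist PX.Metric_space_axioms PY.Metric_space_axioms)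
  \<comment> \<open>In a metric space compactness can be tested on sequences; closedness of the
    fibre keeps the limit inside it.\<close>
  have "\<exists>l r. l \<in> ?F \<and> strict_mono (r :: nat \<Rightarrow> nat) \<and> limitin PZ.mtopology (s \<circ> r) l sequentially"
    if s: "range s \<subseteq> ?F" for s :: "nat \<Rightarrow> ('a \<times> 'b) measure"
  proof -
    have sP: "s n \<in> kantorovich_space (X \<times> Y) (sum_dist dX dY)" and sK: "marginals X dX Y dY (s n) \<in> K" for n
      using s by auto
    have "\<exists>S. finite S \<and> S \<noteq> {} \<and> S \<subseteq> X \<times> Y \<and> (\<forall>n. (\<integral>u. (INF v\<in>S. sum_dist dX dY v u) \<partial>(s n)) \<le> \<epsilon>)"
      if \<epsilon>: "0 < \<epsilon>" for \<epsilon>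
    proof -
      have e2: "0 < \<epsilon> / 2" using \<epsilon> by simp
      have ne: "fst ` K \<noteq> {}" "snd ` K \<noteq> {}" using sK by auto
      obtain A where A: "finite A" "A \<noteq> {}" "A \<subseteq> X" "\<And>p. p \<in> fst ` K \<Longrightarrow> (\<integral>y. (INF a\<in>A. dX a y) \<partial>p) \<le> \<epsilon> / 2"
        using X.compactin_kantorovich_finite_approximation[OF KX ne(1) e2] by blast
      obtain B where B: "finite B" "B \<noteq> {}" "B \<subseteq> Y" "\<And>p. p \<in> snd ` K \<Longrightarrow> (\<integral>y. (INF a\<in>B. dY a y) \<partial>p) \<le> \<epsilon> / 2"
        using Y.compactin_kantorovich_finite_approximation[OF KY ne(2) e2] by blast
      have AB: "A \<times> B \<subseteq> X \<times> Y" "A \<times> B \<noteq> {}" using A B by auto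
      have "(\<integral>u. (INF v\<in>A \<times> B. sum_dist dX dY v u) \<partial>(s n)) \<le> \<epsilon>" for n
      proof -
        let ?p = "distr (s n) (borel_on X dX) fst" and ?q = "distr (s n) (borel_on Y dY) snd"
        have pq: "?p \<in> kantorovich_space X dX" "?q \<in> kantorovich_space Y dY" "?p \<in> fst ` K" "?q \<in> snd ` K"
          using marginals_in_kantorovich_space[OF assms(1,3)] sP[of n] sK[of n]
          by (auto simp: marginals_def image_iff intro: bexI[OF _ sK[of n]])
        have fm: "fst \<in> measurable (s n) (borel_on X dX)" "snd \<in> measurable (s n) (borel_on Y dY)"
          using continuous_map_measurable_borel_on[OF Z.Metric_space_axioms assms(1) continuous_map_fst_snd_sum_dist(1)[OF assms(1,3)]]
            continuous_map_measurable_borel_on[OF Z.Metric_space_axioms assms(3) continuous_map_fst_snd_sum_dist(2)[OF assms(1,3)]]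
            Z.kantorovich_spaceD(2)[OF sP[of n]] by (simp_all cong: measurable_cong_sets)
        note mA = X.dist_set_measurable[OF A(3,2)] and mB = Y.dist_set_measurable[OF B(3,2)]
        have iA: "integrable (s n) (\<lambda>u. INF a\<in>A. dX a (fst u))" and iB: "integrable (s n) (\<lambda>u. INF b\<in>B. dY b (snd u))"
          using X.integrable_dist_set[OF pq(1) A(3,2)] Y.integrable_dist_set[OF pq(2) B(3,2)]
            integrable_distr_eq[OF fm(1) mA] integrable_distr_eq[OF fm(2) mB] by simp_all
        have "(\<integral>u. (INF v\<in>A \<times> B. sum_dist dX dY v u) \<partial>(s n)) \<le> (\<integral>u. (INF a\<in>A. dX a (fst u)) + (INF b\<in>B. dY b (snd u)) \<partial>(s n))"
        proof (rule integral_mono[OF Z.integrable_dist_set[OF sP AB] Bochner_Integration.integrable_add[OF iA iB]])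
          fix u
          \<comment> \<open>Both infima run over finite sets and are attained; the pair of nearest
            points then competes in the infimum over \<open>A \<times> B\<close>.\<close>
          have "(INF a\<in>A. dX a (fst u)) \<in> (\<lambda>a. dX a (fst u)) ` A" "(INF b\<in>B. dY b (snd u)) \<in> (\<lambda>b. dY b (snd u)) ` B"
            using A(1,2) B(1,2) by (simp_all only: cInf_eq_Min finite_imageI image_is_empty Min_in not_False_eq_True)
          then obtain a b where ab: "a \<in> A" "b \<in> B" "(INF a\<in>A. dX a (fst u)) = dX a (fst u)" "(INF b\<in>B. dY b (snd u)) = dY b (snd u)"
            by blast
          have "(INF v\<in>A \<times> B. sum_dist dX dY v u) \<le> sum_dist dX dY (a, b) u" using ab by (intro Z.dist_set_le) auto
          then show "(INF v\<in>A \<times> B. sum_dist dX dY v u) \<le> (INF a\<in>A. dX a (fst u)) + (INF b\<in>B. dY b (snd u))"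
            using ab by (cases u) simp
        qed
        also have "\<dots> = (\<integral>x. (INF a\<in>A. dX a x) \<partial>?p) + (\<integral>y. (INF b\<in>B. dY b y) \<partial>?q)"
          using Bochner_Integration.integral_add[OF iA iB] integral_distr[OF fm(1) mA] integral_distr[OF fm(2) mB] by simp
        finally show ?thesis using A(4)[OF pq(3)] B(4)[OF pq(4)] by linarith
      qed
      then show ?thesis using A(1) B(1) AB by (intro exI[of _ "A \<times> B"]) auto
    qed
    from Z.kantorovich_convergent_subsequence[OF mcomplete_sum_dist[OF assms] sP this]
    obtain q r where q: "strict_mono r" "limitin PZ.mtopology (s \<circ> r) q sequentially" by blast
    have "q \<in> ?F"
      using sP sK by (intro limitin_closedin[OF q(2) closed]) simp_all
    with q show ?thesis by blast
  qed
  then show "compactin PZ.mtopology ?F"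
    unfolding PZ.compactin_sequentially by blast
qed

end
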